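(* Let $r$ be a positive integer and $V=\{1,\dots,r\}$. (1) The rank-selected subposets $P_{[1,2]}$ of $r$-differential posets are in bijection with the hypergraphs $H$ over $V=\{1,\dots,r\}$ such that all hyperedges of $H$ have positive dimension and any 2-subset of $V$ is contained in exactly one hyperedge of $H$. (2) Fix an $r$-differential poset $P$ with rank function $p_0=1,\ p_1=r,\ p_2,\dots$, and let $T_1$ denote the sum of the dimensions of the hyperedges of the hypergraph associated with $P_{[1,2]}$ as in part (1). Then $$p_2=r(r+1)-T_1.$$ (3) The maximum value that $p_2$ may assume for an $r$-differential poset is $r^2+1$; it is achieved by the Fibonacci $r$-differential poset $Z(r)$, whose associated hypergraph is the $(r-1)$-simplex. (4) If $r>1$, the next largest value $p_2$ may assume is $r^2-r+3$, corresponding to a hypergraph with one $(r-2)$-dimensional hyperedge and $r-1$ 1-dimensional hyperedges. (5) The smallest value $p_2$ may assume is $\binom{r+2}{2}-1$; it is achieved by $Y^r$ (the Cartesian product of $r$ copies of the Young lattice $Y$), whose associated hypergraph is $K_r$.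
   Context: Let $r$ be a positive integer and let $P=\bigcup_{n\ge 0}P_n$ be a locally finite graded poset ($P_n$ is the set of elements of rank $n$) with a unique element of rank zero. $P$ is $r$-differential if: (i) two distinct elements $x,y\in P$ cover $k$ common elements if and only if they are covered by $k$ common elements; and (ii) an element $x\in P$ covers $m$ elements if and only if it is covered by $m+r$ elements. Its rank function is $p_n=|P_n|$. The rank-selected subposet $P_{[1,2]}$ is the poset $P_1\cup P_2$ of elements of $P$ of rank 1 or 2. A hypergraph over $V=\{1,\dots,r\}$ is a pair $H=(V,E)$, where $E$ is a collection of nonempty subsets of $V$, called hyperedges. The dimension of a hyperedge $F$ is $|F|-1$. The $(r-1)$-simplex is the hypergraph over $V$ whose only hyperedge is $V$ itself. $K_r$ denotes the complete graph on $V$, identified with the hypergraph whose hyperedges are exactly the 2-subsets of $V$. The hypergraph associated with $P_{[1,2]}$ is obtained as follows: identify the elements of $P_1$ with the integers $1,\dots,r$; the hyperedges are the sets $\{a_1,\dots,a_t\}\subseteq V$ with $t\ge 2$ such that $a_1,\dots,a_t$ are the elements of $P_1$ covered by some $x\in P_2$. $Y$ is the Young lattice (integer partitions ordered by inclusion of Young diagrams), and $Y^r$ carries the componentwise order. The Fibonacci $r$-differential poset $Z(r)$ is obtained from the one-element poset (of rank 0) by infinitely iterating the following step: given the ranks $P_0,\dots,P_j$, define $P_{j+1}$ by placing, for each $y\in P_{j-1}$ (with $P_{-1}=\emptyset$), one element covering exactly those $x\in P_j$ that cover $y$, and, for each $x\in P_j$, $r$ new elements each covering only $x$.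
   Formalization: In (3), for r=1 the hypergraph of Z(1) is empty, not the 0-simplex (hyperedges need t≥2). In (4), for r=2 the only value of p_2 is 5=r^2+1=r^2-r+3, so "next largest" and the hypergraph description are claimed only for r>2. *)

theory Defs
  imports Main "HOL-Library.FuncSet"
begin

text \<open>
  A poset is given by its order relation P, with carrier \<^term>\<open>Field P\<close>: the library
  predicate \<^term>\<open>Partial_order P\<close>.  Order isomorphisms are the library constant
  \<^const>\<open>iso\<close>; see the fact \<open>iso_iff2\<close>.
\<close>

definition covers :: "'a rel \<Rightarrow> 'a \<Rightarrow> 'a \<Rightarrow> bool" where
  "covers P y x \<longleftrightarrow> (x, y) \<in> P \<and> x \<noteq> y \<and>
     (\<forall>z. (x, z) \<in> P \<and> (z, y) \<in> P \<longrightarrow> z = x \<or> z = y)"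

definition covered_set :: "'a rel \<Rightarrow> 'a \<Rightarrow> 'a set" where
  "covered_set P x = {y. covers P x y}"

definition covering_set :: "'a rel \<Rightarrow> 'a \<Rightarrow> 'a set" where
  "covering_set P x = {y. covers P y x}"

definition minimals :: "'a rel \<Rightarrow> 'a set" where
  "minimals P = {x \<in> Field P. \<forall>y. (y, x) \<in> P \<longrightarrow> y = x}"

definition locally_finite :: "'a rel \<Rightarrow> bool" where
  "locally_finite P \<longleftrightarrow> (\<forall>x y. finite {z. (x, z) \<in> P \<and> (z, y) \<in> P})"

definition rank_function :: "'a rel \<Rightarrow> ('a \<Rightarrow> nat) \<Rightarrow> bool" where
  "rank_function P rk \<longleftrightarrow>
     (\<forall>x\<in>minimals P. rk x = 0) \<and> (\<forall>x y. covers P y x \<longrightarrow> rk y = Suc (rk x))"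

definition graded :: "'a rel \<Rightarrow> bool" where
  "graded P \<longleftrightarrow> (\<exists>rk. rank_function P rk)"

text \<open>On locally finite posets the choice below is immaterial on \<^term>\<open>Field P\<close>, by the lemma that
  follows.\<close>

definition poset_rank :: "'a rel \<Rightarrow> 'a \<Rightarrow> nat" where
  "poset_rank P = (SOME rk. rank_function P rk)"

lemma rank_function_unique:
  assumes po: "Partial_order P" and lf: "locally_finite P"
    and rk: "rank_function P rk" and rk': "rank_function P rk'" and x: "x \<in> Field P"
  shows "rk x = rk' x"
  using x
proof (induction "rk x" arbitrary: x rule: less_induct)
  case less
  have tr: "trans P" and an: "antisym P" and rf: "refl_on (Field P) P"
    using po by (auto simp: partial_order_on_def preorder_on_def)
  show ?case
  proof (cases "x \<in> minimals P")
    case True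
    then show ?thesis using rk rk' by (simp add: rank_function_def)
  next
    case False
    then obtain y where y: "(y, x) \<in> P" "y \<noteq> x"
      using less.prems by (auto simp: minimals_def)
    define S where "S = {z. (y, z) \<in> P \<and> (z, x) \<in> P \<and> z \<noteq> x}"
    have "finite S"
      using lf unfolding locally_finite_def S_def
      by (rule_tac finite_subset[of _ "{z. (y, z) \<in> P \<and> (z, x) \<in> P}"]) auto
    moreover have "y \<in> S"
      using y rf by (auto simp: S_def refl_on_def Field_def)
    moreover define R where "R = {(b, a). (a, b) \<in> P \<and> a \<noteq> b}"
    have "wf (Restr R S)"
    proof (rule finite_acyclic_wf)
      show "finite (Restr R S)" using \<open>finite S\<close> by blast
      have "trans R" using tr an unfolding trans_def antisym_def R_def by blast
      then have "R\<^sup>+ = R" by (simp add: trancl_id)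
      then have "acyclic R" by (auto simp: acyclic_def R_def)
      then show "acyclic (Restr R S)" by (rule acyclic_subset) auto
    qed
    ultimately obtain z where z: "z \<in> S" "\<And>w. (w, z) \<in> Restr R S \<Longrightarrow> w \<notin> S"
      by (metis wfE_min)
    have "covers P x z"
      unfolding covers_def
    proof (intro conjI allI impI)
      show "(z, x) \<in> P" "z \<noteq> x" using z(1) by (auto simp: S_def)
      fix w assume w: "(z, w) \<in> P \<and> (w, x) \<in> P"
      show "w = z \<or> w = x"
      proof (rule ccontr)
        assume c: "\<not> (w = z \<or> w = x)"
        have "(y, w) \<in> P" using w z(1) tr by (auto simp: S_def dest: transD)
        then have "w \<in> S" using w c by (auto simp: S_def)
        moreover have "(w, z) \<in> R" using w c by (auto simp: R_def)
        ultimately show False using z by blast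
      qed
    qed
    then have e: "rk x = Suc (rk z)" "rk' x = Suc (rk' z)"
      using rk rk' by (auto simp: rank_function_def)
    have "z \<in> Field P" using z(1) by (auto simp: S_def Field_def)
    then have "rk z = rk' z" using less.hyps[of z] e by simp
    then show ?thesis using e by simp
  qed
qed

definition rank_level :: "'a rel \<Rightarrow> nat \<Rightarrow> 'a set" where
  "rank_level P n = {x \<in> Field P. poset_rank P x = n}"

definition rank_number :: "'a rel \<Rightarrow> nat \<Rightarrow> nat" where
  "rank_number P n = card (rank_level P n)"

definition rank_selected :: "'a rel \<Rightarrow> nat set \<Rightarrow> 'a rel" where
  "rank_selected P S = Restr P (\<Union>n\<in>S. rank_level P n)"

text \<open>Needed because \<^const>\<open>card\<close> is 0 on infinite sets.\<close>

definition has_card :: "'a set \<Rightarrow> nat \<Rightarrow> bool" where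
  "has_card S n \<longleftrightarrow> finite S \<and> card S = n"

definition differential_poset :: "nat \<Rightarrow> 'a rel \<Rightarrow> bool" where
  "differential_poset r P \<longleftrightarrow>
     Partial_order P \<and> locally_finite P \<and> graded P \<and> (\<exists>!x. x \<in> rank_level P 0) \<and>
     (\<forall>x\<in>Field P. \<forall>y\<in>Field P. \<forall>k. x \<noteq> y \<longrightarrow>
        (has_card (covered_set P x \<inter> covered_set P y) k \<longleftrightarrow>
         has_card (covering_set P x \<inter> covering_set P y) k)) \<and>
     (\<forall>x\<in>Field P. \<forall>m. has_card (covered_set P x) m \<longleftrightarrow> has_card (covering_set P x) (m + r))"

text \<open>The vertex set is always \<open>{1..r}\<close>, so a hypergraph is given by its set of hyperedges.\<close>

definition edge_dim :: "nat set \<Rightarrow> nat" where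
  "edge_dim F = card F - 1"

definition hypergraph :: "nat \<Rightarrow> nat set set \<Rightarrow> bool" where
  "hypergraph r E \<longleftrightarrow> (\<forall>F\<in>E. F \<noteq> {} \<and> F \<subseteq> {1..r})"

definition pair_covering_hypergraphs :: "nat \<Rightarrow> nat set set set" where
  "pair_covering_hypergraphs r =
     {E. hypergraph r E \<and> (\<forall>F\<in>E. edge_dim F > 0) \<and>
         (\<forall>p. p \<subseteq> {1..r} \<and> card p = 2 \<longrightarrow> (\<exists>!F. F \<in> E \<and> p \<subseteq> F))}"

definition simplex_hypergraph :: "nat \<Rightarrow> nat set set" where
  "simplex_hypergraph r = {{1..r}}"

definition complete_graph :: "nat \<Rightarrow> nat set set" where
  "complete_graph r = {p. p \<subseteq> {1..r} \<and> card p = 2}"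

definition total_dim :: "nat set set \<Rightarrow> nat" where
  "total_dim E = (\<Sum>F\<in>E. edge_dim F)"

definition labelling :: "nat \<Rightarrow> 'a rel \<Rightarrow> ('a \<Rightarrow> nat) \<Rightarrow> bool" where
  "labelling r P l \<longleftrightarrow> bij_betw l (rank_level P 1) {1..r}"

text \<open>In the following definition Q is the subposet of ranks 1 and 2 of a differential poset and
  l identifies its elements of rank 1 with \<open>1, \<dots>, r\<close>.  Only elements of rank 2 cover anything
  in Q.\<close>

definition associated_hypergraph :: "'a rel \<Rightarrow> ('a \<Rightarrow> nat) \<Rightarrow> nat set set" where
  "associated_hypergraph Q l =
     {l ` covered_set Q x | x. x \<in> Field Q \<and> card (covered_set Q x) \<ge> 2}"

definition labelled_subposets :: "nat \<Rightarrow> ('a rel \<times> ('a \<Rightarrow> nat)) set" where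
  "labelled_subposets r =
     {(rank_selected P {1, 2}, l) | P l. differential_poset r P \<and> labelling r P l}"

text \<open>If Q is the subposet of ranks 1 and 2 of P, then \<^term>\<open>minimals Q\<close> is the set of elements of
  rank 1 of P.\<close>

definition labelled_iso ::
  "nat \<Rightarrow> (('a rel \<times> ('a \<Rightarrow> nat)) \<times> ('a rel \<times> ('a \<Rightarrow> nat))) set" where
  "labelled_iso r =
     {((Q, l), (Q', l')). (Q, l) \<in> labelled_subposets r \<and> (Q', l') \<in> labelled_subposets r \<and>
        (\<exists>f. iso Q Q' f \<and> (\<forall>a\<in>minimals Q. l' (f a) = l a))}"

text \<open>\<open>Fib_Refl y\<close> is the element added for y two ranks above y; \<open>Fib_New x i\<close>, with \<open>i < r\<close>,
  are the elements covering only x.\<close>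

datatype fib = Fib_Zero | Fib_Refl fib | Fib_New fib nat

fun fib_level :: "nat \<Rightarrow> nat \<Rightarrow> fib set" where
  "fib_level r 0 = {Fib_Zero}"
| "fib_level r (Suc 0) = {Fib_New x i | x i. x \<in> fib_level r 0 \<and> i < r}"
| "fib_level r (Suc (Suc j)) =
     Fib_Refl ` fib_level r j \<union> {Fib_New x i | x i. x \<in> fib_level r (Suc j) \<and> i < r}"

text \<open>Pairs are (lower element, upper element).\<close>

inductive_set fib_covers :: "nat \<Rightarrow> fib rel" for r :: nat where
  new: "x \<in> fib_level r n \<Longrightarrow> i < r \<Longrightarrow> (x, Fib_New x i) \<in> fib_covers r"
| reflect: "(y, x) \<in> fib_covers r \<Longrightarrow> (x, Fib_Refl y) \<in> fib_covers r"

definition fibonacci_poset :: "nat \<Rightarrow> fib rel" where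
  "fibonacci_poset r = Restr ((fib_covers r)\<^sup>*) (\<Union>n. fib_level r n)"

text \<open>A partition is the weakly decreasing sequence of its parts, padded with zeros.\<close>

definition partitions :: "(nat \<Rightarrow> nat) set" where
  "partitions = {p. antimono p \<and> finite {i. p i \<noteq> 0}}"

definition young_diagram :: "(nat \<Rightarrow> nat) \<Rightarrow> (nat \<times> nat) set" where
  "young_diagram p = {(i, j). j < p i}"

definition young_lattice :: "(nat \<Rightarrow> nat) rel" where
  "young_lattice =
     {(p, q). p \<in> partitions \<and> q \<in> partitions \<and> young_diagram p \<subseteq> young_diagram q}"

definition poset_power :: "'a rel \<Rightarrow> nat \<Rightarrow> (nat \<Rightarrow> 'a) rel" where
  "poset_power P r =
     {(f, g). f \<in> {1..r} \<rightarrow>\<^sub>E Field P \<and> g \<in> {1..r} \<rightarrow>\<^sub>E Field P \<and>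
              (\<forall>i\<in>{1..r}. (f i, g i) \<in> P)}"

end

theory Submission
  imports Defs "HOL-Library.Countable_Set"
begin

text \<open>
  In a differential poset every atom is covered by \<open>r + 1\<close> elements and two atoms by exactly one
  common element.  Hence ranks 1 and 2 form a linear space: the lines are
  the hyperedges, and they determine how many elements of rank 2 lie above a given atom only.
  Counting incidences gives \<open>p\<^sub>2 + T\<^sub>1 = r (r + 1)\<close>.  Conversely, a linear space is completed to a
  differential poset by reflecting each rank two steps up and adding r new elements above every
  element: this preserves both conditions at the next rank, whatever the ranks below are.

  The hyperedges through a vertex partition the other vertices, so their dimensions add up to
  \<open>r - 1\<close>; this bounds \<open>T\<^sub>1\<close> from below.  The upper bound \<open>r choose 2\<close> counts pairs of vertices.
\<close>

section \<open>Pair-covering hypergraphs\<close>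

text \<open>The hypergraph records only the lines, so the classification hinges on recovering the
  rest of rank 2: over a vertex on d lines there are exactly \<open>r + 1 - d\<close> elements with
  that single label, and \<open>d \<le> r - 1\<close> keeps this number positive. Two labelled
  subposets with the same hypergraph therefore match by a bijection respecting labels; dropping the
  labels amounts to permuting the vertices. For realization, the reflected extension is built on a
  datatype; it is countable, so an injection carries it into any infinite type. Reflection works
  because the upper covers of x are copies of its lower covers plus r private elements, whence
  common upper covers are copies of common lower ones. The second value is
  \<open>r * (r + 1) - (2 * r - 3) = r^2 - r + 3\<close>; the bound \<open>2 * r - 3\<close> is
  attained by a near-pencil, a line on all points but one together with the pairs through the
  remaining point. At r = 2 it equals \<open>r - 1\<close>, so the two values coincide. At r = 1 the
  simplex has an edge of dimension 0, so the hypergraph is empty there.\<close>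

lemma pair_coveringD:
  assumes "E \<in> pair_covering_hypergraphs r"
  shows "finite E" "\<And>F. F \<in> E \<Longrightarrow> F \<subseteq> {1..r}" "\<And>F. F \<in> E \<Longrightarrow> finite F" "\<And>F. F \<in> E \<Longrightarrow> 2 \<le> card F"
proof -
  show sub: "F \<subseteq> {1..r}" if "F \<in> E" for F
    using assms that by (auto simp: pair_covering_hypergraphs_def hypergraph_def)
  then have "E \<subseteq> Pow {1..r}" by blast
  then show "finite E" by (rule finite_subset) simp
  show "finite F" if "F \<in> E" for F using sub[OF that] by (rule finite_subset) simp
  show "2 \<le> card F" if "F \<in> E" for F
    using assms that by (auto simp: pair_covering_hypergraphs_def edge_dim_def)
qed

lemma pair_covering_ex:
  assumes "E \<in> pair_covering_hypergraphs r" "v \<in> {1..r}" "w \<in> {1..r}" "v \<noteq> w"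
  obtains F where "F \<in> E" "v \<in> F" "w \<in> F"
proof -
  have "{v, w} \<subseteq> {1..r}" "card {v, w} = 2" using assms by auto
  then have "\<exists>!F. F \<in> E \<and> {v, w} \<subseteq> F"
    using assms(1) unfolding pair_covering_hypergraphs_def by blast
  then show ?thesis using that by blast
qed

text \<open>In linear-space terms, distinct lines meet in at most one point; the disjointness claims
  in the counts below rest on this.\<close>

lemma pair_covering_unique:
  assumes "E \<in> pair_covering_hypergraphs r" "F \<in> E" "G \<in> E" "v \<noteq> w"
    "v \<in> F" "w \<in> F" "v \<in> G" "w \<in> G"
  shows "F = G"
proof -
  have "{v, w} \<subseteq> {1..r}" "card {v, w} = 2"
    using assms pair_coveringD(2)[OF assms(1,2)] by auto
  then have "\<exists>!F. F \<in> E \<and> {v, w} \<subseteq> F"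
    using assms(1) unfolding pair_covering_hypergraphs_def by blast
  then show ?thesis using assms by blast
qed

section \<open>Bounds on the total dimension\<close>

lemma sum_edge_dim_star:
  assumes E: "E \<in> pair_covering_hypergraphs r" and v: "v \<in> {1..r}"
  shows "(\<Sum>F | F \<in> E \<and> v \<in> F. edge_dim F) = r - 1"
proof -
  let ?S = "{F \<in> E. v \<in> F}"
  have "{1..r} - {v} = (\<Union>F\<in>?S. F - {v})"
  proof
    show "{1..r} - {v} \<subseteq> (\<Union>F\<in>?S. F - {v})"
    proof
      fix w assume w: "w \<in> {1..r} - {v}"
      then obtain F where "F \<in> E" "v \<in> F" "w \<in> F"
        using pair_covering_ex[OF E v, of w] by blast
      then show "w \<in> (\<Union>F\<in>?S. F - {v})" using w by blast
    qed
    show "(\<Union>F\<in>?S. F - {v}) \<subseteq> {1..r} - {v}" using pair_coveringD(2)[OF E] by blast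
  qed
  then have "r - 1 = card (\<Union>F\<in>?S. F - {v})" using v by (metis card_Diff_singleton card_atLeastAtMost diff_Suc_1)
  also have "\<dots> = (\<Sum>F\<in>?S. card (F - {v}))"
  proof (rule card_UN_disjoint)
    show "finite ?S" "\<forall>F\<in>?S. finite (F - {v})" using pair_coveringD(1,3)[OF E] by auto
    show "\<forall>F\<in>?S. \<forall>G\<in>?S. F \<noteq> G \<longrightarrow> (F - {v}) \<inter> (G - {v}) = {}"
      using pair_covering_unique[OF E] by blast
  qed
  also have "\<dots> = (\<Sum>F\<in>?S. edge_dim F)"
    by (intro sum.cong) (auto simp: edge_dim_def)
  finally show ?thesis by simp
qed

lemma total_dim_ge:
  assumes E: "E \<in> pair_covering_hypergraphs r"
  shows "r - 1 \<le> total_dim E"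
proof (cases "r = 0")
  case False
  then have "(\<Sum>F | F \<in> E \<and> 1 \<in> F. edge_dim F) = r - 1"
    by (intro sum_edge_dim_star[OF E]) auto
  moreover have "(\<Sum>F | F \<in> E \<and> 1 \<in> F. edge_dim F) \<le> total_dim E"
    unfolding total_dim_def using pair_coveringD(1)[OF E] by (intro sum_mono2) auto
  ultimately show ?thesis by simp
qed simp

text \<open>Every edge has two points, which also lie on the full edge, so uniqueness of the line
  through them identifies both edges. The resulting dichotomy separates the maximum of
  \<open>p\<^sub>2\<close> from its other values and identifies the hypergraph of the Fibonacci
  poset.\<close>

lemma full_edge_imp_simplex:
  assumes E: "E \<in> pair_covering_hypergraphs r" and "{1..r} \<in> E"
  shows "E = simplex_hypergraph r"
proof -
  have "F = {1..r}" if F: "F \<in> E" for F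
  proof -
    obtain v w where "v \<in> F" "w \<in> F" "v \<noteq> w"
      using pair_coveringD(4)[OF E F] by (metis card_le_Suc0_iff_eq card.infinite not_less_eq_eq numeral_2_eq_2 zero_le)
    then show ?thesis using pair_covering_unique[OF E F assms(2)] pair_coveringD(2)[OF E F] by blast
  qed
  then show ?thesis using assms(2) unfolding simplex_hypergraph_def by blast
qed

text \<open>Take an edge G, two of its points v and w, and a point u outside G.  The edges through v or w
  have total dimension \<open>2(r - 1) - dim G\<close>, and the edges joining u to the other points of G are
  further \<open>dim G - 1\<close> edges.\<close>

lemma total_dim_ge_no_full_edge:
  assumes E: "E \<in> pair_covering_hypergraphs r" and full: "{1..r} \<notin> E" and r: "2 \<le> r"
  shows "2 * r - 3 \<le> total_dim E"
proof -
  have "1 \<in> {1..r}" "2 \<in> {1..r}" "(1::nat) \<noteq> 2" using r by auto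
  then obtain G where G: "G \<in> E" "1 \<in> G" "2 \<in> G" by (rule pair_covering_ex[OF E])
  obtain u where u: "u \<in> {1..r}" "u \<notin> G"
    using full G(1) pair_coveringD(2)[OF E G(1)] by (metis subsetI subset_antisym)
  have "\<exists>F. F \<in> E \<and> u \<in> F \<and> g \<in> F" if "g \<in> G" for g
    using that u pair_coveringD(2)[OF E G(1)] pair_covering_ex[OF E u(1), of g] by blast
  then obtain e where e: "\<And>g. g \<in> G \<Longrightarrow> e g \<in> E \<and> u \<in> e g \<and> g \<in> e g" by metis
  \<comment> \<open>The edge \<open>e g\<close> meets G only in g: a second common point would make
    it equal to G, which misses u.\<close>
  have eq: "h = g" if "g \<in> G" "h \<in> G" "h \<in> e g" for g h
    using pair_covering_unique[OF E G(1), of "e g" g h] e[OF that(1)] that u by blast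
  define S where "S v = {F \<in> E. v \<in> F}" for v :: nat
  define T where "T = e ` (G - {1, 2})"
  have fin: "finite (S v)" for v using pair_coveringD(1)[OF E] by (simp add: S_def)
  have finT: "finite T" using pair_coveringD(3)[OF E G(1)] by (simp add: T_def)
  have disj: "(S 1 \<union> S 2) \<inter> T = {}"
    using G eq by (auto simp: S_def T_def)
  have inter: "S 1 \<inter> S 2 = {G}"
  proof -
    have "F = G" if "F \<in> E" "1 \<in> F" "2 \<in> F" for F
      by (rule pair_covering_unique[OF E, of _ _ 1 2]) (use that G in simp_all)
    then show ?thesis using G unfolding S_def by blast
  qed
  have "inj_on e (G - {1, 2})"
  proof (rule inj_onI)
    fix g h assume gh: "g \<in> G - {1, 2}" "h \<in> G - {1, 2}" "e g = e h"
    then have "h \<in> e g" using e[of h] by simp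
    then show "g = h" using eq[of g h] gh by simp
  qed
  then have "card T = card G - 2"
    using G pair_coveringD(3)[OF E G(1)] by (simp add: T_def card_image card_Diff_subset)
  moreover have "card T \<le> (\<Sum>F\<in>T. edge_dim F)"
  proof -
    have "1 \<le> edge_dim F" if "F \<in> T" for F
      using that e pair_coveringD(4)[OF E] by (fastforce simp: T_def edge_dim_def)
    then have "(\<Sum>F\<in>T. 1) \<le> (\<Sum>F\<in>T. edge_dim F)" by (intro sum_mono) auto
    then show ?thesis by simp
  qed
  \<comment> \<open>Each star sums to r - 1 and the stars share exactly G, so
    \<open>edge_dim G\<close> is the correction term of inclusion-exclusion.\<close>
  moreover have "(\<Sum>F\<in>S 1 \<union> S 2. edge_dim F) + edge_dim G = 2 * (r - 1)"
  proof -
    have "(\<Sum>F\<in>S v. edge_dim F) = r - 1" if "v \<in> {1, 2}" for v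
      unfolding S_def using that r by (intro sum_edge_dim_star[OF E]) auto
    then show ?thesis using sum.union_inter[OF fin[of 1] fin[of 2], of edge_dim] inter by simp
  qed
  moreover have "(\<Sum>F\<in>S 1 \<union> S 2. edge_dim F) + (\<Sum>F\<in>T. edge_dim F) \<le> total_dim E"
  proof -
    have "(\<Sum>F\<in>S 1 \<union> S 2. edge_dim F) + (\<Sum>F\<in>T. edge_dim F) = (\<Sum>F\<in>S 1 \<union> S 2 \<union> T. edge_dim F)"
      using fin finT disj by (simp add: sum.union_disjoint)
    also have "\<dots> \<le> total_dim E"
      unfolding total_dim_def using pair_coveringD(1)[OF E] e
      by (intro sum_mono2) (auto simp: S_def T_def)
    finally show ?thesis .
  qed
  moreover have "edge_dim G + 1 = card G" "2 \<le> card G"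
    using pair_coveringD(4)[OF E G(1)] by (auto simp: edge_dim_def)
  ultimately show ?thesis by linarith
qed

lemma total_dim_le:
  assumes E: "E \<in> pair_covering_hypergraphs r"
  shows "total_dim E \<le> r choose 2"
proof -
  let ?p = "\<lambda>F::nat set. {p. p \<subseteq> F \<and> card p = 2}"
  have "total_dim E \<le> (\<Sum>F\<in>E. card (?p F))"
    unfolding total_dim_def
  proof (rule sum_mono)
    fix F assume F: "F \<in> E"
    \<comment> \<open>A line on n points has dimension n - 1 but contains \<open>n choose 2\<close>
      pairs; both numbers are 1 at n = 2, which is why the complete graph is extremal.\<close>
    have "n - 1 \<le> n choose 2" for n :: nat
      by (induction n) (auto simp: numeral_2_eq_2)
    then show "edge_dim F \<le> card (?p F)"
      using pair_coveringD(3)[OF E F] by (simp add: edge_dim_def n_subsets)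
  qed
  also have "\<dots> = card (\<Union>F\<in>E. ?p F)"
  proof (rule card_UN_disjoint[symmetric])
    show "\<forall>F\<in>E. finite (?p F)" using pair_coveringD(3)[OF E] by auto
    have "F = G" if "F \<in> E" "G \<in> E" "p \<subseteq> F" "p \<subseteq> G" "card p = 2" for F G p
      using that pair_covering_unique[OF E that(1,2)] by (metis card_2_iff insert_subset)
    then show "\<forall>F\<in>E. \<forall>G\<in>E. F \<noteq> G \<longrightarrow> ?p F \<inter> ?p G = {}" by blast
  qed (rule pair_coveringD(1)[OF E])
  also have "\<dots> \<le> card (?p {1..r})"
    by (intro card_mono) (use pair_coveringD(2)[OF E] in \<open>fastforce+\<close>)
  also have "\<dots> = r choose 2" by (simp add: n_subsets)
  finally show ?thesis .
qed

section \<open>Extremal hypergraphs: complete graph, simplex and near-pencil\<close>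

lemma complete_graph_unique:
  assumes E: "E \<in> pair_covering_hypergraphs r" and two: "\<And>F. F \<in> E \<Longrightarrow> card F \<le> 2"
  shows "E = complete_graph r"
proof
  show "E \<subseteq> complete_graph r"
    using pair_coveringD[OF E] two by (force simp: complete_graph_def)
  show "complete_graph r \<subseteq> E"
  proof
    fix p assume p: "p \<in> complete_graph r"
    then obtain F where F: "F \<in> E" "p \<subseteq> F"
      using E unfolding pair_covering_hypergraphs_def complete_graph_def by blast
    \<comment> \<open>The line through the pair p has at most two points, so it is p itself.\<close>
    moreover have "p = F"
      using p F two pair_coveringD(3)[OF E F(1)]
      by (intro card_seteq) (auto simp: complete_graph_def)
    ultimately show "p \<in> E" by simp
  qed
qed

lemma total_dim_complete_graph: "total_dim (complete_graph r) = r choose 2"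
proof -
  have "total_dim (complete_graph r) = (\<Sum>F\<in>complete_graph r. 1)"
    unfolding total_dim_def by (intro sum.cong) (auto simp: complete_graph_def edge_dim_def)
  then show ?thesis by (simp add: complete_graph_def n_subsets)
qed

lemma complete_graph_pair_covering: "complete_graph r \<in> pair_covering_hypergraphs r"
proof -
  have *: "p = F" if "p \<subseteq> F" "card p = 2" "card F = 2" for p F :: "nat set"
    using that by (intro card_seteq) (auto intro: card_ge_0_finite)
  have "\<exists>!F. F \<in> complete_graph r \<and> p \<subseteq> F" if "p \<subseteq> {1..r}" "card p = 2" for p
    using that by (intro ex1I[of _ p]) (auto simp: complete_graph_def dest: *)
  then show ?thesis
    by (auto simp: pair_covering_hypergraphs_def hypergraph_def edge_dim_def)
      (auto simp: complete_graph_def)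
qed

lemma total_dim_simplex: "total_dim (simplex_hypergraph r) = r - 1"
  by (simp add: total_dim_def simplex_hypergraph_def edge_dim_def)

text \<open>The only edge has dimension r - 1, which is positive from r = 2 on.\<close>

lemma simplex_pair_covering: "2 \<le> r \<Longrightarrow> simplex_hypergraph r \<in> pair_covering_hypergraphs r"
  by (auto simp: pair_covering_hypergraphs_def hypergraph_def simplex_hypergraph_def edge_dim_def)

text \<open>On one vertex no set has positive dimension and there is no pair to cover. This is the
  case in which the simplex has to be replaced by the empty hypergraph.\<close>

lemma pair_covering_1: "pair_covering_hypergraphs (Suc 0) = {{}}"
proof -
  have False if "p \<subseteq> {Suc 0}" "card p = 2" for p
    using card_mono[OF _ that(1)] that(2) by simp
  moreover have False if "F \<subseteq> {Suc 0}" "0 < card F - Suc 0" for F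
    using card_mono[OF _ that(1)] that(2) by simp
  ultimately show ?thesis
    by (auto simp: pair_covering_hypergraphs_def hypergraph_def edge_dim_def)
qed

text \<open>The vertex r lies off the long line F and is joined to each of its points by a pair.
  Since r > 2, the line F has positive dimension; the total \<open>(r - 2) + (r - 1)\<close> meets
  the bound of \<open>total_dim_ge_no_full_edge\<close>.\<close>

lemma near_pencil:
  assumes r: "2 < r"
  defines "F \<equiv> {1..r - 1}" and "G \<equiv> (\<lambda>i. {i, r}) ` {1..r - 1}"
  shows "insert F G \<in> pair_covering_hypergraphs r" "F \<notin> G" "edge_dim F = r - 2"
    "card G = r - 1" "\<forall>e\<in>G. edge_dim e = 1" "total_dim (insert F G) = 2 * r - 3"
proof -
  have "r \<notin> F" using r by (auto simp: F_def)
  then show FG: "F \<notin> G" by (auto simp: G_def)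
  show F: "edge_dim F = r - 2" by (simp add: F_def edge_dim_def)
  have "inj_on (\<lambda>i. {i, r}) {1..r - 1}" by (intro inj_onI) (auto simp: doubleton_eq_iff)
  then show G: "card G = r - 1" by (simp add: G_def card_image)
  show e: "\<forall>e\<in>G. edge_dim e = 1" using r by (auto simp: G_def edge_dim_def)
  have "finite G" by (simp add: G_def)
  then show "total_dim (insert F G) = 2 * r - 3"
    using FG F G e r by (simp add: total_dim_def)
  have "\<exists>!H. H \<in> insert F G \<and> p \<subseteq> H" if p: "p \<subseteq> {1..r}" "card p = 2" for p
  proof -
    \<comment> \<open>With v < w the pair contains r exactly when w = r, which decides between a
      pair in G and the line F.\<close>
    obtain v w where vw: "p = {v, w}" "v < w"
      using p(2) by (metis card_2_iff insert_commute linorder_neqE_nat)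
    show ?thesis
    proof (cases "w = r")
      case True
      then show ?thesis using p vw r by (intro ex1I[of _ "{v, r}"]) (auto simp: F_def G_def)
    next
      case False
      then show ?thesis using p vw r by (intro ex1I[of _ F]) (auto simp: F_def G_def)
    qed
  qed
  then show "insert F G \<in> pair_covering_hypergraphs r"
    using r F e by (auto simp: pair_covering_hypergraphs_def hypergraph_def F_def G_def)
qed

section \<open>Incidence structures\<close>

text \<open>The abstract form of ranks 1 and 2: B is the set of elements of rank 2, and \<open>k x\<close> is the set
  of labels of the elements covered by x.\<close>

locale incidence =
  fixes r :: nat and B :: "'b set" and k :: "'b \<Rightarrow> nat set"
  assumes finite_B: "finite B"
    and k_sub: "x \<in> B \<Longrightarrow> k x \<noteq> {} \<and> k x \<subseteq> {1..r}"
    and degree: "v \<in> {1..r} \<Longrightarrow> card {x \<in> B. v \<in> k x} = r + 1"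
    and pair: "v \<in> {1..r} \<Longrightarrow> w \<in> {1..r} \<Longrightarrow> v \<noteq> w \<Longrightarrow> card {x \<in> B. v \<in> k x \<and> w \<in> k x} = 1"

text \<open>The abstract counterpart of \<open>associated_hypergraph\<close>. Elements with a single
  label are forgotten; \<open>card_fibre\<close> recovers their number.\<close>

definition incidence_edges :: "'b set \<Rightarrow> ('b \<Rightarrow> nat set) \<Rightarrow> nat set set" where
  "incidence_edges B k = {k x | x. x \<in> B \<and> 2 \<le> card (k x)}"

context incidence
begin

lemma finite_k: "x \<in> B \<Longrightarrow> finite (k x)"
  using k_sub finite_subset by blast

lemma pair_unique:
  assumes "x \<in> B" "y \<in> B" "v \<noteq> w" "v \<in> k x" "w \<in> k x" "v \<in> k y" "w \<in> k y"
  shows "x = y"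
proof -
  have "card {x \<in> B. v \<in> k x \<and> w \<in> k x} = 1" using assms k_sub by (intro pair) blast+
  then obtain z where "{x \<in> B. v \<in> k x \<and> w \<in> k x} = {z}" by (auto simp: card_1_singleton_iff)
  moreover have "x \<in> {x \<in> B. v \<in> k x \<and> w \<in> k x}" "y \<in> {x \<in> B. v \<in> k x \<and> w \<in> k x}"
    using assms by simp_all
  ultimately show ?thesis by simp
qed

text \<open>Equal label sets with two members give two elements above the same pair, and only one
  element lies there. Elements with a single label are not separated by k.\<close>

lemma inj_on_lines: "inj_on k {x \<in> B. 2 \<le> card (k x)}"
proof (rule inj_onI)
  fix x y assume *: "x \<in> {x \<in> B. 2 \<le> card (k x)}" "y \<in> {x \<in> B. 2 \<le> card (k x)}" "k x = k y"
  then obtain v w where "v \<in> k x" "w \<in> k x" "v \<noteq> w"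
    by (metis (no_types, lifting) card_le_Suc0_iff_eq finite_k mem_Collect_eq not_less_eq_eq numeral_2_eq_2)
  then show "x = y" using * pair_unique by blast
qed

lemma edges_eq: "incidence_edges B k = k ` {x \<in> B. 2 \<le> card (k x)}"
  by (auto simp: incidence_edges_def)

lemma edges_pair_covering: "incidence_edges B k \<in> pair_covering_hypergraphs r"
proof -
  have "\<exists>!F. F \<in> incidence_edges B k \<and> p \<subseteq> F" if p: "p \<subseteq> {1..r}" "card p = 2" for p
  proof -
    obtain v w where vw: "p = {v, w}" "v \<noteq> w" using p(2) by (auto simp: card_2_iff)
    then obtain x where x: "{x \<in> B. v \<in> k x \<and> w \<in> k x} = {x}"
      using pair[of v w] p(1) by (auto simp: card_1_singleton_iff)
    then have "x \<in> B" "p \<subseteq> k x" using vw by auto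
    moreover have "2 \<le> card (k x)"
      using card_mono[OF finite_k, OF \<open>x \<in> B\<close> \<open>p \<subseteq> k x\<close>] p by simp
    ultimately show ?thesis using x vw by (intro ex1I[of _ "k x"]) (auto simp: edges_eq)
  qed
  moreover have "hypergraph r (incidence_edges B k)"
    using k_sub by (auto simp: hypergraph_def edges_eq)
  moreover have "\<forall>F\<in>incidence_edges B k. 0 < edge_dim F" by (auto simp: edges_eq edge_dim_def)
  ultimately show ?thesis by (simp add: pair_covering_hypergraphs_def)
qed

lemma card_plus_total_dim: "card B + total_dim (incidence_edges B k) = r * (r + 1)"
proof -
  have "total_dim (incidence_edges B k) = (\<Sum>x | x \<in> B \<and> 2 \<le> card (k x). edge_dim (k x))"
    by (simp add: total_dim_def edges_eq sum.reindex[OF inj_on_lines])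
  \<comment> \<open>An element with a single label has dimension 0, so the sum extends from the
    lines to all of B.\<close>
  also have "\<dots> = (\<Sum>x\<in>B. edge_dim (k x))"
    by (intro sum.mono_neutral_left) (auto simp: finite_B edge_dim_def)
  finally have "card B + total_dim (incidence_edges B k) = (\<Sum>x\<in>B. 1 + edge_dim (k x))"
    by (simp only: sum.distrib card_eq_sum)
  also have "\<dots> = (\<Sum>x\<in>B. card (k x))"
  proof (rule sum.cong)
    fix x assume "x \<in> B"
    then have "0 < card (k x)" using k_sub finite_k by (simp add: card_gt_0_iff)
    then show "1 + edge_dim (k x) = card (k x)" by (simp add: edge_dim_def)
  qed simp
  also have "\<dots> = (\<Sum>x\<in>B. \<Sum>v | v \<in> {1..r} \<and> v \<in> k x. 1)"
  proof (rule sum.cong)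
    fix x assume "x \<in> B"
    then have "{v. v \<in> {1..r} \<and> v \<in> k x} = k x" using k_sub by blast
    then show "card (k x) = (\<Sum>v | v \<in> {1..r} \<and> v \<in> k x. 1)" by simp
  qed simp
  also have "\<dots> = (\<Sum>v\<in>{1..r}. \<Sum>x | x \<in> B \<and> v \<in> k x. 1)"
    by (rule sum.swap_restrict) (auto simp: finite_B)
  also have "\<dots> = (\<Sum>v\<in>{1..r}. r + 1)"
    by (intro sum.cong) (use degree in auto)
  finally show ?thesis by simp
qed

text \<open>Of the r + 1 elements above a vertex v, those with a second label correspond to the
  edges through v, and the remaining ones have label set {v}; over an edge, injectivity on lines
  leaves one element. The right-hand side mentions only r and the hypergraph, and this makes the
  classification injective.\<close>

lemma card_fibre:
  "card {x \<in> B. k x = S} =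
    (if S \<in> incidence_edges B k then 1
     else if \<exists>v\<in>{1..r}. S = {v} then r + 1 - card {F \<in> incidence_edges B k. S \<subseteq> F} else 0)"
proof -
  consider (edge) "S \<in> incidence_edges B k" | (point) v where "v \<in> {1..r}" "S = {v}"
    | (none) "S \<notin> incidence_edges B k" "\<nexists>v. v \<in> {1..r} \<and> S = {v}" by blast
  then show ?thesis
  proof cases
    case edge
    then obtain x where "x \<in> B" "S = k x" "2 \<le> card (k x)" by (auto simp: edges_eq)
    then have "{y \<in> B. k y = S} = {x}" using inj_on_lines by (auto simp: inj_on_def)
    then show ?thesis using edge by simp
  next
    case point
    let ?L = "{x \<in> B. 2 \<le> card (k x) \<and> v \<in> k x}"
    have "{x \<in> B. v \<in> k x} = {x \<in> B. k x = {v}} \<union> ?L"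
    proof -
      have "k x = {v}" if "x \<in> B" "v \<in> k x" "\<not> 2 \<le> card (k x)" for x
      proof -
        have "card (k x) \<noteq> 0" using that finite_k by auto
        then have "card (k x) = 1" using that(3) by linarith
        then show ?thesis using that by (auto simp: card_1_singleton_iff)
      qed
      then show ?thesis by auto
    qed
    moreover have "card ({x \<in> B. k x = {v}} \<union> ?L) = card {x \<in> B. k x = {v}} + card ?L"
      using finite_B by (intro card_Un_disjoint) auto
    moreover have "{F \<in> incidence_edges B k. {v} \<subseteq> F} = k ` ?L" by (auto simp: edges_eq)
    then have "card {F \<in> incidence_edges B k. {v} \<subseteq> F} = card ?L"
      using inj_on_subset[OF inj_on_lines, of ?L] by (simp add: card_image Collect_mono)
    moreover have "{v} \<notin> incidence_edges B k" using pair_coveringD(4)[OF edges_pair_covering, of "{v}"] by auto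
    ultimately show ?thesis using degree[OF point(1)] point by auto
  next
    case none
    have "x \<notin> B" if "k x = S" for x
    proof
      assume x: "x \<in> B"
      then have "card S \<noteq> 0" "\<not> 2 \<le> card S"
        using none(1) k_sub[OF x] finite_k[OF x] that by (auto simp: edges_eq)
      then have "card S = 1" by simp
      then show False using none(2) k_sub[OF x] that by (auto simp: card_1_singleton_iff)
    qed
    then have "{x \<in> B. k x = S} = {}" by blast
    moreover have "\<not> (\<exists>v\<in>{1..r}. S = {v})" using none(2) by blast
    ultimately show ?thesis using none(1) by (metis card.empty)
  qed
qed

end

text \<open>Bijections between corresponding fibres are chosen one by one and glued; elements of
  different fibres cannot collide, since their images have different
  \<open>k'\<close>-values.\<close>

lemma fibrewise_bij:
  assumes "finite B" "finite B'" "\<And>S. card {x \<in> B. k x = S} = card {x \<in> B'. k' x = S}"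
  obtains h where "bij_betw h B B'" "\<And>x. x \<in> B \<Longrightarrow> k' (h x) = k x"
proof -
  have "\<exists>\<phi>. bij_betw \<phi> {x \<in> B. k x = S} {x \<in> B'. k' x = S}" for S
    using assms by (intro finite_same_card_bij) auto
  then obtain \<phi> where \<phi>: "\<And>S. bij_betw (\<phi> S) {x \<in> B. k x = S} {x \<in> B'. k' x = S}" by metis
  define h where "h x = \<phi> (k x) x" for x
  have h: "h x \<in> B'" "k' (h x) = k x" if "x \<in> B" for x
    using bij_betwE[OF \<phi>[of "k x"]] that by (auto simp: h_def)
  have "inj_on h B"
  proof (rule inj_onI)
    fix x y assume "x \<in> B" "y \<in> B" "h x = h y"
    then show "x = y"
      using h(2)[of x] h(2)[of y] bij_betw_imp_inj_on[OF \<phi>[of "k x"]] by (auto simp: h_def inj_on_def)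
  qed
  moreover have "h ` B = B'"
  proof
    show "B' \<subseteq> h ` B"
    proof
      fix y assume "y \<in> B'"
      then obtain x where "x \<in> B" "k x = k' y" "\<phi> (k' y) x = y"
        using bij_betw_imp_surj_on[OF \<phi>[of "k' y"]] by (smt (verit) imageE mem_Collect_eq)
      then show "y \<in> h ` B" by (auto simp: h_def intro!: rev_image_eqI[of x])
    qed
  qed (use h in auto)
  ultimately show ?thesis using that h(2) by (simp add: bij_betw_def)
qed

text \<open>By \<open>card_fibre\<close> the fibre sizes on both sides are the same function of r
  and the common hypergraph.\<close>

lemma incidence_bij:
  assumes "incidence r B k" "incidence r B' k'" "incidence_edges B k = incidence_edges B' k'"
  obtains h where "bij_betw h B B'" "\<And>x. x \<in> B \<Longrightarrow> k' (h x) = k x"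
proof (rule fibrewise_bij)
  show "finite B" "finite B'" using assms(1,2) by (auto simp: incidence_def)
  show "card {x \<in> B. k x = S} = card {x \<in> B'. k' x = S}" for S
    using assms by (simp only: incidence.card_fibre)
qed (rule that)

text \<open>Every edge through v contributes at least 1 to a sum equal to r - 1. Hence the
  natural-number difference \<open>r + 1 - card {F \<in> E. v \<in> F}\<close> does not
  truncate.\<close>

lemma card_star_le:
  assumes E: "E \<in> pair_covering_hypergraphs r" and v: "v \<in> {1..r}"
  shows "card {F \<in> E. v \<in> F} \<le> r - 1"
proof -
  have "1 \<le> edge_dim F" if "F \<in> E" for F
    using pair_coveringD(4)[OF E that] by (simp add: edge_dim_def)
  then have "(\<Sum>F | F \<in> E \<and> v \<in> F. 1) \<le> (\<Sum>F | F \<in> E \<and> v \<in> F. edge_dim F)"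
    by (intro sum_mono) auto
  then show ?thesis by (simp add: sum_edge_dim_star[OF E v])
qed

text \<open>One element per edge, and over each vertex as many elements with a single label as the
  degree r + 1 still requires. The second component only tells copies apart.\<close>

lemma ex_incidence:
  assumes E: "E \<in> pair_covering_hypergraphs r"
  obtains B :: "(nat set \<times> nat) set" where "incidence r B fst" "incidence_edges B fst = E"
proof
  define d where "d v = r + 1 - card {F \<in> E. v \<in> F}" for v
  define N where "N v = (\<lambda>i. ({v}, i)) ` {..<d v}" for v
  define B where "B = (\<lambda>F. (F, 0)) ` E \<union> (\<Union>v\<in>{1..r}. N v)"
  note E' = pair_coveringD[OF E]
  \<comment> \<open>Both kinds of elements are pairs of a set and a number; they stay apart because
    no edge is a singleton.\<close>
  have not_single: "{v} \<notin> E" for v using E'(4)[of "{v}"] by auto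
  have B_cases: thesis if "x \<in> B" "\<And>F. F \<in> E \<Longrightarrow> x = (F, 0) \<Longrightarrow> thesis"
    "\<And>v i. v \<in> {1..r} \<Longrightarrow> x = ({v}, i) \<Longrightarrow> thesis" for x thesis
    using that unfolding B_def N_def by blast
  show "incidence r B fst"
  proof
    show "finite B" using E'(1) by (simp add: B_def N_def)
    show "fst x \<noteq> {} \<and> fst x \<subseteq> {1..r}" if "x \<in> B" for x
    proof (rule B_cases[OF that])
      fix F assume F: "F \<in> E" "x = (F, 0)"
      then have "F \<noteq> {}" using E'(4)[OF F(1)] by auto
      then show ?thesis using E'(2)[OF F(1)] F(2) by simp
    qed auto
    show "card {x \<in> B. v \<in> fst x} = r + 1" if v: "v \<in> {1..r}" for v
    proof -
      have "{x \<in> B. v \<in> fst x} = (\<lambda>F. (F, 0)) ` {F \<in> E. v \<in> F} \<union> N v"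
      proof
        show "{x \<in> B. v \<in> fst x} \<subseteq> (\<lambda>F. (F, 0)) ` {F \<in> E. v \<in> F} \<union> N v"
          unfolding B_def N_def by fastforce
        show "(\<lambda>F. (F, 0)) ` {F \<in> E. v \<in> F} \<union> N v \<subseteq> {x \<in> B. v \<in> fst x}"
          using v unfolding B_def N_def by fastforce
      qed
      moreover have "card ((\<lambda>F. (F, 0::nat)) ` {F \<in> E. v \<in> F} \<union> N v) =
          card ((\<lambda>F. (F, 0::nat)) ` {F \<in> E. v \<in> F}) + card (N v)"
        using E'(1) not_single by (intro card_Un_disjoint) (auto simp: N_def)
      moreover have "card ((\<lambda>F. (F, 0::nat)) ` {F \<in> E. v \<in> F}) = card {F \<in> E. v \<in> F}"
        by (intro card_image inj_onI) auto
      moreover have "card (N v) = d v"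
        unfolding N_def by (subst card_image) (auto intro: inj_onI)
      ultimately show ?thesis using card_star_le[OF E v] by (simp add: d_def)
    qed
    show "card {x \<in> B. v \<in> fst x \<and> w \<in> fst x} = 1"
      if vw: "v \<in> {1..r}" "w \<in> {1..r}" "v \<noteq> w" for v w
    proof -
      obtain F where F: "F \<in> E" "v \<in> F" "w \<in> F" by (rule pair_covering_ex[OF E vw])
      have "{x \<in> B. v \<in> fst x \<and> w \<in> fst x} = {(F, 0)}"
      proof
        show "{(F, 0)} \<subseteq> {x \<in> B. v \<in> fst x \<and> w \<in> fst x}" using F by (simp add: B_def)
        show "{x \<in> B. v \<in> fst x \<and> w \<in> fst x} \<subseteq> {(F, 0)}"
        proof
          fix x assume x: "x \<in> {x \<in> B. v \<in> fst x \<and> w \<in> fst x}"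
          then have "x \<in> B" by simp
          then show "x \<in> {(F, 0)}"
          proof (rule B_cases)
            fix G assume "G \<in> E" "x = (G, 0)"
            then show ?thesis using x F vw pair_covering_unique[OF E F(1), of G v w] by simp
          qed (use x vw in auto)
        qed
      qed
      then show ?thesis by simp
    qed
  qed
  show "incidence_edges B fst = E"
  proof
    show "incidence_edges B fst \<subseteq> E"
      by (auto simp: incidence_edges_def elim!: B_cases)
    show "E \<subseteq> incidence_edges B fst"
    proof
      fix F assume "F \<in> E"
      then have "(F, 0) \<in> B" "2 \<le> card F" using E'(4) by (auto simp: B_def)
      then show "F \<in> incidence_edges B fst" by (force simp: incidence_edges_def)
    qed
  qed
qed

section \<open>Ranks 0, 1 and 2 of a differential poset\<close>

text \<open>The rank function is a parameter, since the constructions below bring their own;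
  \<open>rank_level\<close> shows that it agrees with the chosen \<open>poset_rank\<close>.\<close>

locale graded_poset =
  fixes P :: "'a rel" and rk :: "'a \<Rightarrow> nat"
  assumes po: "Partial_order P" and lf: "locally_finite P" and rank: "rank_function P rk"
begin

lemma refl: "x \<in> Field P \<Longrightarrow> (x, x) \<in> P"
  using po by (auto simp: partial_order_on_def preorder_on_def refl_on_def)

lemma trans: "(x, y) \<in> P \<Longrightarrow> (y, z) \<in> P \<Longrightarrow> (x, z) \<in> P"
  using po by (auto simp: partial_order_on_def preorder_on_def dest: transD)

lemma antisym: "(x, y) \<in> P \<Longrightarrow> (y, x) \<in> P \<Longrightarrow> x = y"
  using po by (auto simp: partial_order_on_def dest: antisymD)

lemma covers_Field: "covers P y x \<Longrightarrow> x \<in> Field P \<and> y \<in> Field P"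
  by (auto simp: covers_def Field_def)

text \<open>Among the elements from y on and strictly below x, take one whose interval up to x is
  smallest; an element strictly between would have a smaller interval. Local finiteness makes the
  sizes comparable.\<close>

lemma ex_covered_above:
  assumes "(y, x) \<in> P" "y \<noteq> x"
  obtains z where "(y, z) \<in> P" "covers P x z"
proof -
  define S where "S = {z. (y, z) \<in> P \<and> (z, x) \<in> P \<and> z \<noteq> x}"
  define I where "I z = {w. (z, w) \<in> P \<and> (w, x) \<in> P}" for z
  have "y \<in> S" using assms refl by (auto simp: S_def Field_def)
  then obtain z where z: "z \<in> S" and min: "\<And>w. w \<in> S \<Longrightarrow> card (I z) \<le> card (I w)"
    using ex_has_least_nat[of "\<lambda>z. z \<in> S" y "\<lambda>z. card (I z)"] by blast
  have "w = z" if w: "(z, w) \<in> P" "(w, x) \<in> P" "w \<noteq> x" for w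
  proof (rule ccontr)
    assume "w \<noteq> z"
    have "z \<in> Field P" using w by (auto simp: Field_def)
    then have "z \<in> I z" using z refl by (auto simp: I_def S_def)
    moreover have "z \<notin> I w" using \<open>w \<noteq> z\<close> w antisym by (auto simp: I_def)
    moreover have "I w \<subseteq> I z" using w trans by (auto simp: I_def)
    ultimately have "I w \<subset> I z" by blast
    moreover have "finite (I z)" using lf by (simp add: I_def locally_finite_def)
    ultimately have "card (I w) < card (I z)" by (rule psubset_card_mono[rotated])
    moreover have "w \<in> S" using z w trans by (auto simp: S_def)
    ultimately show False using min[of w] by simp
  qed
  then have "covers P x z" using z by (auto simp: covers_def S_def)
  then show ?thesis using that z by (auto simp: S_def)
qed

lemma covers_rank: "covers P y x \<Longrightarrow> rk y = Suc (rk x)"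
  using rank by (auto simp: rank_function_def)

lemma rank_less: "(y, x) \<in> P \<Longrightarrow> y \<noteq> x \<Longrightarrow> rk y < rk x"
proof (induction "rk x" arbitrary: x rule: less_induct)
  case less
  obtain z where z: "(y, z) \<in> P" "covers P x z" by (rule ex_covered_above[OF less.prems])
  have "rk y \<le> rk z"
  proof (cases "y = z")
    case False
    then show ?thesis using less.hyps[of z] z covers_rank[OF z(2)] by simp
  qed simp
  then show ?case using covers_rank[OF z(2)] by simp
qed

lemma covers_iff: "covers P y x \<longleftrightarrow> (x, y) \<in> P \<and> rk y = Suc (rk x)"
proof
  assume *: "(x, y) \<in> P \<and> rk y = Suc (rk x)"
  have "z = x \<or> z = y" if "(x, z) \<in> P" "(z, y) \<in> P" for z
    using rank_less[OF that(1)] rank_less[OF that(2)] * by fastforce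
  then show "covers P y x" using * by (auto simp: covers_def)
qed (auto simp: covers_rank, simp add: covers_def)

lemma rank_level: "rank_level P n = {x \<in> Field P. rk x = n}"
proof -
  have "rank_function P (poset_rank P)"
    unfolding poset_rank_def using rank by (rule someI[of "rank_function P"])
  then show ?thesis
    using rank_function_unique[OF po lf rank] by (auto simp: rank_level_def)
qed

lemma ex_covered:
  assumes "x \<in> Field P" "rk x = Suc n"
  obtains y where "covers P x y"
proof -
  have "x \<notin> minimals P" using assms rank by (auto simp: rank_function_def)
  then obtain y where "(y, x) \<in> P" "y \<noteq> x" using assms by (auto simp: minimals_def)
  then show ?thesis using ex_covered_above that by blast
qed

text \<open>Once all neighbourhoods are finite, the equivalences between \<open>has_card\<close>
  statements become equations between cardinalities.\<close>

lemma differential_posetI: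
  assumes "\<exists>!x. x \<in> Field P \<and> rk x = 0"
    and fin: "\<And>x. x \<in> Field P \<Longrightarrow> finite (covered_set P x)" "\<And>x. x \<in> Field P \<Longrightarrow> finite (covering_set P x)"
    and card: "\<And>x. x \<in> Field P \<Longrightarrow> card (covering_set P x) = card (covered_set P x) + r"
    and common: "\<And>x y. x \<in> Field P \<Longrightarrow> y \<in> Field P \<Longrightarrow> x \<noteq> y \<Longrightarrow>
      card (covered_set P x \<inter> covered_set P y) = card (covering_set P x \<inter> covering_set P y)"
  shows "differential_poset r P"
  unfolding differential_poset_def has_card_def
proof (intro conjI ballI allI impI)
  show "graded P" using rank by (auto simp: graded_def)
  show "\<exists>!x. x \<in> rank_level P 0" using assms(1) by (simp add: rank_level)
qed (use po lf fin card common in auto)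

end

locale differential =
  fixes r :: nat and P :: "'a rel"
  assumes diff: "differential_poset r P"

sublocale differential \<subseteq> graded_poset P "poset_rank P"
proof
  show "Partial_order P" "locally_finite P" using diff by (auto simp: differential_poset_def)
  show "rank_function P (poset_rank P)"
    unfolding poset_rank_def
    by (rule someI_ex[of "rank_function P"]) (use diff in \<open>simp add: differential_poset_def graded_def\<close>)
qed

context differential
begin

definition zero :: 'a where "zero = (THE x. x \<in> rank_level P 0)"

lemma level_0: "rank_level P 0 = {zero}"
proof -
  have ex1: "\<exists>!x. x \<in> rank_level P 0" using diff by (simp add: differential_poset_def)
  then have "zero \<in> rank_level P 0" unfolding zero_def by (rule theI')
  then show ?thesis using ex1 by blast
qed

lemma covered_level:
  assumes "x \<in> rank_level P n" "y \<in> covered_set P x"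
  shows "0 < n" "y \<in> rank_level P (n - 1)"
  using assms covers_rank covers_Field by (auto simp: covered_set_def rank_level_def)

lemma covering_level:
  assumes "x \<in> rank_level P n" "y \<in> covering_set P x"
  shows "y \<in> rank_level P (Suc n)"
  using assms covers_rank covers_Field by (auto simp: covering_set_def rank_level_def)

lemma covered_nonempty: "x \<in> rank_level P (Suc n) \<Longrightarrow> covered_set P x \<noteq> {}"
  using ex_covered[of x n] by (auto simp: rank_level_def covered_set_def)

text \<open>Instantiating the axiom at the size of the covered set gives finiteness together with
  the size, so finiteness spreads upwards from the bottom element.\<close>

lemma card_covering:
  assumes "x \<in> Field P" "finite (covered_set P x)"
  shows "finite (covering_set P x)" "card (covering_set P x) = card (covered_set P x) + r"
  using diff assms unfolding differential_poset_def has_card_def by blast+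

lemma card_common:
  assumes "x \<in> Field P" "y \<in> Field P" "x \<noteq> y" "finite (covered_set P x \<inter> covered_set P y)"
  shows "card (covering_set P x \<inter> covering_set P y) = card (covered_set P x \<inter> covered_set P y)"
  using diff assms unfolding differential_poset_def has_card_def by blast

lemma level_Field: "x \<in> rank_level P n \<Longrightarrow> x \<in> Field P"
  by (simp add: rank_level_def)

lemma level_Suc: "rank_level P (Suc n) = (\<Union>x\<in>rank_level P n. covering_set P x)"
proof
  show "rank_level P (Suc n) \<subseteq> (\<Union>x\<in>rank_level P n. covering_set P x)"
  proof
    fix x assume x: "x \<in> rank_level P (Suc n)"
    then obtain y where "y \<in> covered_set P x" using covered_nonempty by blast
    then show "x \<in> (\<Union>x\<in>rank_level P n. covering_set P x)"
      using covered_level(2)[OF x] by (auto simp: covered_set_def covering_set_def)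
  qed
qed (use covering_level in blast)

lemma covered_zero: "covered_set P zero = {}"
  using covered_level(1)[of zero 0] level_0 by auto

lemma card_level_1: "finite (rank_level P 1)" "card (rank_level P 1) = r"
proof -
  have "rank_level P 1 = covering_set P zero" using level_Suc[of 0] by (simp add: level_0)
  moreover have "zero \<in> Field P" using level_0 level_Field by blast
  ultimately show "finite (rank_level P 1)" "card (rank_level P 1) = r"
    using card_covering[of zero] by (simp_all add: covered_zero)
qed

lemma covered_atom: "a \<in> rank_level P 1 \<Longrightarrow> covered_set P a = {zero}"
  using covered_level(2)[of a 1] covered_nonempty[of a 0] level_0 by auto

lemma card_covering_atom:
  assumes "a \<in> rank_level P 1"
  shows "finite (covering_set P a)" "card (covering_set P a) = r + 1"
  using card_covering[of a] level_Field[OF assms] covered_atom[OF assms] by auto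

text \<open>Both atoms cover exactly \<open>zero\<close>: one common element below, hence one
  above.\<close>

lemma card_common_atoms:
  assumes "a \<in> rank_level P 1" "b \<in> rank_level P 1" "a \<noteq> b"
  shows "card (covering_set P a \<inter> covering_set P b) = 1"
  using card_common[of a b] assms level_Field covered_atom by simp

lemma finite_level_2: "finite (rank_level P 2)"
  using level_Suc[of 1] card_covering_atom(1) card_level_1(1) by (simp add: numeral_2_eq_2)

lemma covered_level_2: "x \<in> rank_level P 2 \<Longrightarrow> covered_set P x \<subseteq> rank_level P 1"
  using covered_level(2)[of x 2] by auto

lemma ex_labelling: "\<exists>l. labelling r P l"
  unfolding labelling_def using card_level_1 by (intro finite_same_card_bij) auto

section \<open>The subposet of ranks 1 and 2\<close>

abbreviation (input) Q :: "'a rel" where "Q \<equiv> rank_selected P {1, 2}"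

lemma levels_disjoint: "x \<in> rank_level P m \<Longrightarrow> x \<in> rank_level P n \<Longrightarrow> m = n"
  by (simp add: rank_level_def)

lemma rank_selected_12:
  "(x, y) \<in> Q \<longleftrightarrow>
    (x, y) \<in> P \<and> x \<in> rank_level P 1 \<union> rank_level P 2 \<and> y \<in> rank_level P 1 \<union> rank_level P 2"
  by (simp add: rank_selected_def)

text \<open>A strict relation inside two consecutive ranks goes from rank 1 to rank 2 and is a cover
  in P. This reduces the order of Q to \<open>covered_set P\<close>.\<close>

lemma Q_iff: "(x, y) \<in> Q \<longleftrightarrow> x = y \<and> x \<in> rank_level P 1 \<union> rank_level P 2 \<or>
    y \<in> rank_level P 2 \<and> x \<in> covered_set P y"
proof
  assume "(x, y) \<in> Q"
  note xy = this[unfolded rank_selected_12]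
  show "x = y \<and> x \<in> rank_level P 1 \<union> rank_level P 2 \<or> y \<in> rank_level P 2 \<and> x \<in> covered_set P y"
  proof (cases "x = y")
    case True
    then show ?thesis using xy by simp
  next
    case False
    then have "poset_rank P x < poset_rank P y" using xy rank_less by simp
    then have "poset_rank P x = 1" "poset_rank P y = 2" "y \<in> rank_level P 2"
      using xy by (auto simp: rank_level_def)
    then show ?thesis using xy covers_iff by (simp add: covered_set_def)
  qed
next
  assume "x = y \<and> x \<in> rank_level P 1 \<union> rank_level P 2 \<or> y \<in> rank_level P 2 \<and> x \<in> covered_set P y"
  then show "(x, y) \<in> Q"
  proof
    assume "y \<in> rank_level P 2 \<and> x \<in> covered_set P y"
    then show ?thesis
      using covered_level_2[of y] unfolding rank_selected_12 by (auto simp: covered_set_def covers_def)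
  next
    assume "x = y \<and> x \<in> rank_level P 1 \<union> rank_level P 2"
    then show ?thesis using refl[of x] level_Field[of x] unfolding rank_selected_12 by blast
  qed
qed

lemma Field_Q: "Field Q = rank_level P 1 \<union> rank_level P 2"
proof
  show "Field Q \<subseteq> rank_level P 1 \<union> rank_level P 2"
    using rank_selected_12 by (auto simp: Field_def)
  show "rank_level P 1 \<union> rank_level P 2 \<subseteq> Field Q"
    using Q_iff unfolding Field_def by blast
qed

text \<open>Removing the bottom leaves atoms with nothing to cover, while an element of rank 2 keeps
  all the atoms that it covers.\<close>

lemma covered_set_Q: "covered_set Q x = (if x \<in> rank_level P 2 then covered_set P x else {})"
proof -
  have "covers Q x y \<longleftrightarrow> (y, x) \<in> Q \<and> x \<noteq> y" for y
  proof
    assume yx: "(y, x) \<in> Q \<and> x \<noteq> y"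
    then have "x \<in> rank_level P 2 \<and> y \<in> covered_set P x" unfolding Q_iff by blast
    then have y: "y \<in> rank_level P 1" "x \<in> rank_level P 2" using covered_level_2 by blast+
    have "z \<notin> rank_level P 1" if "z \<in> rank_level P 2" for z
      using that levels_disjoint[of z 1 2] by auto
    then have "z = y \<or> z = x" if "(y, z) \<in> Q" "(z, x) \<in> Q" for z
      using that y covered_level_2 unfolding Q_iff by blast
    then show "covers Q x y" using yx by (auto simp: covers_def)
  qed (auto simp: covers_def)
  then have "covered_set Q x = {y. (y, x) \<in> Q \<and> x \<noteq> y}" by (simp add: covered_set_def)
  moreover have "x \<notin> covered_set P x" by (simp add: covered_set_def covers_def)
  ultimately show ?thesis unfolding Q_iff by (cases "x \<in> rank_level P 2") auto
qed

lemma minimals_Q: "minimals Q = rank_level P 1"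
proof
  show "minimals Q \<subseteq> rank_level P 1"
  proof
    fix x assume x: "x \<in> minimals Q"
    then have "x \<notin> rank_level P 2"
    proof -
      have False if x2: "x \<in> rank_level P 2"
      proof -
        obtain y where y: "y \<in> covered_set P x"
          using covered_nonempty[of x 1] x2 by (auto simp: numeral_2_eq_2)
        then have "(y, x) \<in> Q" "y \<noteq> x"
          using Q_iff x2 by (auto simp: covered_set_def covers_def)
        then show False using x by (auto simp: minimals_def)
      qed
      then show ?thesis by blast
    qed
    then show "x \<in> rank_level P 1" using x Field_Q by (auto simp: minimals_def)
  qed
  show "rank_level P 1 \<subseteq> minimals Q"
  proof
    fix x assume x: "x \<in> rank_level P 1"
    then have "x \<notin> rank_level P 2" using levels_disjoint[of x 1 2] by auto
    then show "x \<in> minimals Q" using x Field_Q Q_iff by (auto simp: minimals_def)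
  qed
qed

end

section \<open>Labelled subposets and their hypergraphs\<close>

context differential
begin

definition labels :: "('a \<Rightarrow> nat) \<Rightarrow> 'a \<Rightarrow> nat set" where
  "labels l x = l ` covered_set P x"

lemma label_in_labels_iff:
  assumes "labelling r P l" "a \<in> rank_level P 1" "x \<in> rank_level P 2"
  shows "l a \<in> labels l x \<longleftrightarrow> a \<in> covered_set P x"
  unfolding labels_def using assms covered_level_2[OF assms(3)]
  by (intro inj_on_image_mem_iff[of l "rank_level P 1"]) (auto simp: labelling_def bij_betw_def)

lemma covering_atom_eq:
  assumes "labelling r P l" "a \<in> rank_level P 1"
  shows "{x \<in> rank_level P 2. l a \<in> labels l x} = covering_set P a"
proof -
  have "covering_set P a \<subseteq> rank_level P 2"
    using covering_level[OF assms(2)] by (auto simp: numeral_2_eq_2)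
  moreover have "x \<in> covering_set P a \<longleftrightarrow> a \<in> covered_set P x" for x
    by (simp add: covering_set_def covered_set_def)
  ultimately show ?thesis using label_in_labels_iff[OF assms] by blast
qed

text \<open>The labelling turns the upper covers of one atom into the degree condition and the
  common upper covers of two atoms into the pair condition.\<close>

lemma incidence_labels:
  assumes l: "labelling r P l"
  shows "incidence r (rank_level P 2) (labels l)"
proof
  have image: "l ` rank_level P 1 = {1..r}"
    using l by (simp add: labelling_def bij_betw_def)
  then have atom: "\<exists>a. a \<in> rank_level P 1 \<and> l a = v" if "v \<in> {1..r}" for v
    using that by (metis imageE)
  show "finite (rank_level P 2)" by (rule finite_level_2)
  show "labels l x \<noteq> {} \<and> labels l x \<subseteq> {1..r}" if "x \<in> rank_level P 2" for x
  proof
    show "labels l x \<noteq> {}"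
      using covered_nonempty[of x 1] that by (simp add: labels_def numeral_2_eq_2)
    show "labels l x \<subseteq> {1..r}"
      using covered_level_2[OF that] image by (metis image_mono labels_def)
  qed
  show "card {x \<in> rank_level P 2. v \<in> labels l x} = r + 1" if v: "v \<in> {1..r}" for v
    using atom[OF v] covering_atom_eq[OF l] card_covering_atom(2) by auto
  show "card {x \<in> rank_level P 2. v \<in> labels l x \<and> w \<in> labels l x} = 1"
    if vw: "v \<in> {1..r}" "w \<in> {1..r}" "v \<noteq> w" for v w
  proof -
    obtain a b where ab: "a \<in> rank_level P 1" "b \<in> rank_level P 1" "l a = v" "l b = w"
      using atom[OF vw(1)] atom[OF vw(2)] by blast
    then have "{x \<in> rank_level P 2. v \<in> labels l x \<and> w \<in> labels l x} =
        covering_set P a \<inter> covering_set P b"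
      using covering_atom_eq[OF l ab(1)] covering_atom_eq[OF l ab(2)] by blast
    then show ?thesis using card_common_atoms[OF ab(1,2)] ab vw by auto
  qed
qed

lemma card_labels:
  assumes "labelling r P l" "x \<in> rank_level P 2"
  shows "card (labels l x) = card (covered_set P x)"
  unfolding labels_def using assms covered_level_2[OF assms(2)]
  by (intro card_image) (auto simp: labelling_def bij_betw_def intro: inj_on_subset)

lemma associated_hypergraph_eq:
  assumes "labelling r P l"
  shows "associated_hypergraph Q l = incidence_edges (rank_level P 2) (labels l)"
proof -
  have "x \<in> Field Q \<and> 2 \<le> card (covered_set Q x) \<longleftrightarrow>
      x \<in> rank_level P 2 \<and> 2 \<le> card (labels l x)" for x
    unfolding Field_Q covered_set_Q using card_labels[OF assms, of x] by simp
  moreover have "l ` covered_set Q x = labels l x" if "x \<in> rank_level P 2" for x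
    unfolding covered_set_Q labels_def using that by simp
  ultimately show ?thesis
    unfolding associated_hypergraph_def incidence_edges_def by (smt (verit) Collect_cong)
qed

lemma hypergraph_pair_covering:
  "labelling r P l \<Longrightarrow> associated_hypergraph Q l \<in> pair_covering_hypergraphs r"
  using incidence.edges_pair_covering[OF incidence_labels] associated_hypergraph_eq by simp

text \<open>Stated additively, which avoids truncated subtraction in the comparisons with the bounds
  on \<open>total_dim\<close>.\<close>

lemma rank_number_2:
  "labelling r P l \<Longrightarrow> rank_number P 2 + total_dim (associated_hypergraph Q l) = r * (r + 1)"
  using incidence.card_plus_total_dim[OF incidence_labels] associated_hypergraph_eq
  by (simp add: rank_number_def)

lemma rank_number_0_1: "rank_number P 0 = 1" "rank_number P 1 = r"
  using level_0 card_level_1 by (simp_all add: rank_number_def)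

end

section \<open>Hypergraphs under isomorphism and relabelling\<close>

lemma iso_covered_set:
  assumes iso: "iso R R' f" and x: "x \<in> Field R"
  shows "covered_set R' (f x) = f ` covered_set R x"
proof -
  have bij: "bij_betw f (Field R) (Field R')"
    and iff: "\<And>a b. a \<in> Field R \<Longrightarrow> b \<in> Field R \<Longrightarrow> (a, b) \<in> R \<longleftrightarrow> (f a, f b) \<in> R'"
    using iso by (auto simp: iso_iff2)
  have inj: "f a = f b \<longleftrightarrow> a = b" if "a \<in> Field R" "b \<in> Field R" for a b
    using bij that by (auto simp: bij_betw_def inj_on_def)
  have surj: "\<exists>a. a \<in> Field R \<and> f a = b" if "b \<in> Field R'" for b
    using bij that unfolding bij_betw_def by (metis imageE)
  have covers: "covers R' (f x) (f y) \<longleftrightarrow> covers R x y" if y: "y \<in> Field R" for y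
  proof
    assume c: "covers R' (f x) (f y)"
    have "z = y \<or> z = x" if z: "(y, z) \<in> R" "(z, x) \<in> R" for z
    proof -
      have zF: "z \<in> Field R" using z by (auto simp: Field_def)
      then have "(f y, f z) \<in> R'" "(f z, f x) \<in> R'" using z iff x y by simp_all
      then have "f z = f y \<or> f z = f x" using c by (simp add: covers_def)
      then show ?thesis using inj zF x y by simp
    qed
    then show "covers R x y" using c iff x y by (auto simp: covers_def)
  next
    assume c: "covers R x y"
    have "z = f y \<or> z = f x" if z: "(f y, z) \<in> R'" "(z, f x) \<in> R'" for z
    proof -
      obtain a where a: "a \<in> Field R" "f a = z" using surj[of z] z by (auto simp: Field_def)
      then have "(y, a) \<in> R" "(a, x) \<in> R" using z iff x y by auto
      then show ?thesis using c a by (auto simp: covers_def)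
    qed
    then show "covers R' (f x) (f y)" using c iff inj x y by (auto simp: covers_def)
  qed
  have sub: "y \<in> Field R" if "y \<in> covered_set R x" for y
    using that by (auto simp: covered_set_def covers_def Field_def)
  have sub': "y \<in> Field R'" if "y \<in> covered_set R' (f x)" for y
    using that by (auto simp: covered_set_def covers_def Field_def)
  show ?thesis
  proof (intro equalityI subsetI)
    fix y assume y: "y \<in> covered_set R' (f x)"
    then obtain a where "a \<in> Field R" "f a = y" using sub' surj by blast
    then show "y \<in> f ` covered_set R x" using y covers by (auto simp: covered_set_def)
  next
    fix y assume "y \<in> f ` covered_set R x"
    then show "y \<in> covered_set R' (f x)" using sub covers by (auto simp: covered_set_def)
  qed
qed

lemma iso_associated_hypergraph:
  assumes iso: "iso R R' f"
  shows "associated_hypergraph R' l = associated_hypergraph R (l \<circ> f)"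
proof -
  have bij: "bij_betw f (Field R) (Field R')" using iso by (auto simp: iso_iff2)
  have card: "card (covered_set R' (f x)) = card (covered_set R x)" if "x \<in> Field R" for x
    unfolding iso_covered_set[OF iso that]
    by (rule card_image, rule inj_on_subset[OF bij_betw_imp_inj_on[OF bij]])
      (auto simp: covered_set_def covers_def Field_def)
  have image: "l ` covered_set R' (f x) = (l \<circ> f) ` covered_set R x" if "x \<in> Field R" for x
    unfolding iso_covered_set[OF iso that] by (rule image_comp)
  have "associated_hypergraph R' l =
      {l ` covered_set R' y | y. y \<in> f ` Field R \<and> 2 \<le> card (covered_set R' y)}"
    using bij by (simp add: associated_hypergraph_def bij_betw_def)
  also have "\<dots> = {l ` covered_set R' (f x) | x. x \<in> Field R \<and> 2 \<le> card (covered_set R' (f x))}"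
    by blast
  also have "\<dots> = associated_hypergraph R (l \<circ> f)"
    unfolding associated_hypergraph_def using card image by (smt (verit) Collect_cong)
  finally show ?thesis .
qed

lemma associated_hypergraph_cong:
  assumes "\<And>x a. x \<in> Field R \<Longrightarrow> a \<in> covered_set R x \<Longrightarrow> l a = m a"
  shows "associated_hypergraph R l = associated_hypergraph R m"
proof -
  have "l ` covered_set R x = m ` covered_set R x" if "x \<in> Field R" for x
    using assms that by (intro image_cong) auto
  then show ?thesis unfolding associated_hypergraph_def by (smt (verit) Collect_cong)
qed

lemma associated_hypergraph_image:
  "associated_hypergraph R (\<pi> \<circ> l) = (\<lambda>F. \<pi> ` F) ` associated_hypergraph R l"
  by (auto simp: associated_hypergraph_def image_comp[symmetric])

lemma labelled_subposetsE:
  assumes "(Q, l) \<in> labelled_subposets r"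
  obtains P where "differential r P" "labelling r P l" "Q = rank_selected P {1, 2}"
  using assms by (auto simp: labelled_subposets_def differential_def)

lemma labelled_subposetsI:
  "differential r P \<Longrightarrow> labelling r P l \<Longrightarrow> (rank_selected P {1, 2}, l) \<in> labelled_subposets r"
  by (auto simp: labelled_subposets_def differential_def)

text \<open>Consequently the hypergraph depends on l only through its values on
  \<open>minimals Q\<close>, which are the values that \<open>labelled_iso\<close> compares.\<close>

lemma labelled_covered_minimals:
  assumes "(Q, l) \<in> labelled_subposets r"
  shows "covered_set Q x \<subseteq> minimals Q"
proof -
  obtain P where P: "differential r P" "Q = rank_selected P {1, 2}"
    by (rule labelled_subposetsE[OF assms])
  interpret differential r P by (rule P(1))
  show ?thesis unfolding P(2) minimals_Q covered_set_Q using covered_level_2[of x] by simp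
qed

lemma labelled_bij_minimals:
  assumes "(Q, l) \<in> labelled_subposets r"
  shows "bij_betw l (minimals Q) {1..r}"
proof -
  obtain P where P: "differential r P" "labelling r P l" "Q = rank_selected P {1, 2}"
    by (rule labelled_subposetsE[OF assms])
  interpret differential r P by (rule P(1))
  show ?thesis using P(2) unfolding P(3) minimals_Q labelling_def .
qed

lemma labelled_pair_covering:
  assumes "(Q, l) \<in> labelled_subposets r"
  shows "associated_hypergraph Q l \<in> pair_covering_hypergraphs r"
proof -
  obtain P where P: "differential r P" "labelling r P l" "Q = rank_selected P {1, 2}"
    by (rule labelled_subposetsE[OF assms])
  interpret differential r P by (rule P(1))
  show ?thesis unfolding P(3) by (rule hypergraph_pair_covering[OF P(2)])
qed

text \<open>The map \<pi> is the identity for isomorphisms that preserve labels and a permutation of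
  the vertices for arbitrary ones.\<close>

lemma labelled_iso_hypergraph:
  assumes "(Q, l) \<in> labelled_subposets r" "iso Q Q' f" "\<And>a. a \<in> minimals Q \<Longrightarrow> l' (f a) = \<pi> (l a)"
  shows "associated_hypergraph Q' l' = (\<lambda>F. \<pi> ` F) ` associated_hypergraph Q l"
proof -
  have "associated_hypergraph Q' l' = associated_hypergraph Q (l' \<circ> f)"
    by (rule iso_associated_hypergraph[OF assms(2)])
  also have "\<dots> = associated_hypergraph Q (\<pi> \<circ> l)"
    using assms(3) labelled_covered_minimals[OF assms(1)]
    by (intro associated_hypergraph_cong) auto
  finally show ?thesis by (simp add: associated_hypergraph_image)
qed

lemma labelled_relabel:
  assumes "(Q, l) \<in> labelled_subposets r" "bij_betw \<pi> {1..r} {1..r}"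
  shows "(Q, \<pi> \<circ> l) \<in> labelled_subposets r"
proof -
  obtain P where P: "differential r P" "labelling r P l" "Q = rank_selected P {1, 2}"
    by (rule labelled_subposetsE[OF assms(1)])
  have "labelling r P (\<pi> \<circ> l)"
    using P(2) assms(2) unfolding labelling_def by (rule bij_betw_trans)
  then show ?thesis using labelled_subposetsI[OF P(1)] P(3) by simp
qed

lemma iso_minimals:
  assumes iso: "iso R R' f" and a: "a \<in> minimals R"
  shows "f a \<in> minimals R'"
proof -
  have bij: "bij_betw f (Field R) (Field R')"
    and iff: "\<And>a b. a \<in> Field R \<Longrightarrow> b \<in> Field R \<Longrightarrow> (a, b) \<in> R \<longleftrightarrow> (f a, f b) \<in> R'"
    using iso by (auto simp: iso_iff2)
  have aF: "a \<in> Field R" using a by (simp add: minimals_def)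
  have "y = f a" if y: "(y, f a) \<in> R'" for y
  proof -
    have "y \<in> f ` Field R" using y bij by (auto simp: bij_betw_def Field_def)
    then obtain b where b: "b \<in> Field R" "y = f b" by blast
    then have "(b, a) \<in> R" using iff aF y by simp
    then have "b = a" using a by (simp add: minimals_def)
    then show ?thesis using b by simp
  qed
  moreover have "f a \<in> Field R'" using bij aF by (auto simp: bij_betw_def)
  ultimately show ?thesis by (simp add: minimals_def)
qed

lemma iso_inv_into:
  assumes iso: "iso R R' f"
  shows "iso R' R (inv_into (Field R) f)"
proof -
  let ?g = "inv_into (Field R) f"
  have bij: "bij_betw f (Field R) (Field R')"
    and iff: "\<And>a b. a \<in> Field R \<Longrightarrow> b \<in> Field R \<Longrightarrow> (a, b) \<in> R \<longleftrightarrow> (f a, f b) \<in> R'"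
    using iso by (auto simp: iso_iff2)
  have g: "?g b \<in> Field R" "f (?g b) = b" if "b \<in> Field R'" for b
    using bij that by (auto simp: bij_betw_def inv_into_into f_inv_into_f)
  show ?thesis unfolding iso_iff2
    using bij_betw_inv_into[OF bij] iff g by auto
qed

text \<open>On atoms the map is forced by the labels; on rank 2 it is the bijection of
  \<open>incidence_bij\<close>, which preserves label sets. Since the order between the two ranks is
  membership of a label in a label set, the glued map is an isomorphism.\<close>

lemma same_hypergraph_iso:
  assumes Q: "(Q, l) \<in> labelled_subposets r" and Q': "(Q', l') \<in> labelled_subposets r"
    and eq: "associated_hypergraph Q l = associated_hypergraph Q' l'"
  shows "((Q, l), (Q', l')) \<in> labelled_iso r"
proof -
  obtain P where P: "differential r P" "labelling r P l" "Q = rank_selected P {1, 2}"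
    by (rule labelled_subposetsE[OF Q])
  obtain P' where P': "differential r P'" "labelling r P' l'" "Q' = rank_selected P' {1, 2}"
    by (rule labelled_subposetsE[OF Q'])
  interpret P: differential r P by (rule P(1))
  interpret P': differential r P' by (rule P'(1))
  obtain h where h: "bij_betw h (rank_level P 2) (rank_level P' 2)"
    "\<And>x. x \<in> rank_level P 2 \<Longrightarrow> P'.labels l' (h x) = P.labels l x"
    by (rule incidence_bij[OF P.incidence_labels[OF P(2)] P'.incidence_labels[OF P'(2)]])
      (use eq P P' P.associated_hypergraph_eq P'.associated_hypergraph_eq in auto)
  obtain j where j: "bij_betw j (rank_level P 1) (rank_level P' 1)"
    "\<And>a. a \<in> rank_level P 1 \<Longrightarrow> l' (j a) = l a"
  proof
    let ?j = "inv_into (rank_level P' 1) l' \<circ> l"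
    show "bij_betw ?j (rank_level P 1) (rank_level P' 1)"
      using P(2) P'(2) unfolding labelling_def by (blast intro: bij_betw_trans bij_betw_inv_into)
    show "l' (?j a) = l a" if "a \<in> rank_level P 1" for a
    proof -
      have "l a \<in> l' ` rank_level P' 1"
        using P(2) P'(2) that unfolding labelling_def bij_betw_def by blast
      then show ?thesis by (simp add: f_inv_into_f)
    qed
  qed
  have disj: "x \<notin> rank_level P 1" if "x \<in> rank_level P 2" for x
    using P.levels_disjoint[of x 1 2] that by auto
  have disj': "x \<notin> rank_level P' 1" if "x \<in> rank_level P' 2" for x
    using P'.levels_disjoint[of x 1 2] that by auto
  define f where "f x = (if x \<in> rank_level P 1 then j x else h x)" for x
  have f1: "f x = j x" if "x \<in> rank_level P 1" for x using that by (simp add: f_def)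
  have f2: "f x = h x" if "x \<in> rank_level P 2" for x using that disj by (simp add: f_def)
  have f1': "f x \<in> rank_level P' 1" if "x \<in> rank_level P 1" for x
    using bij_betwE[OF j(1)] f1 that by simp
  have f2': "f x \<in> rank_level P' 2" if "x \<in> rank_level P 2" for x
    using bij_betwE[OF h(1)] f2 that by simp
  have bij: "bij_betw f (Field Q) (Field Q')"
    unfolding P(3) P'(3) P.Field_Q P'.Field_Q
  proof (rule bij_betw_combine)
    show "bij_betw f (rank_level P 1) (rank_level P' 1)"
      using bij_betw_cong[THEN iffD1, OF f1[symmetric] j(1)] .
    show "bij_betw f (rank_level P 2) (rank_level P' 2)"
      using bij_betw_cong[THEN iffD1, OF f2[symmetric] h(1)] .
  qed (use disj' in blast)
  have "(x, y) \<in> Q \<longleftrightarrow> (f x, f y) \<in> Q'" if x: "x \<in> Field Q" and y: "y \<in> Field Q" for x y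
  proof -
    have inj: "f x = f y \<longleftrightarrow> x = y"
      using bij x y by (auto simp: bij_betw_def inj_on_def)
    have level: "f z \<in> rank_level P' 2 \<longleftrightarrow> z \<in> rank_level P 2" if "z \<in> Field Q" for z
      using that f1' f2' disj' unfolding P(3) P.Field_Q by blast
    have fx: "f x \<in> rank_level P' 1 \<union> rank_level P' 2" "x \<in> rank_level P 1 \<union> rank_level P 2"
      using x f1' f2' unfolding P(3) P.Field_Q by blast+
    \<comment> \<open>For an atom x, both sides say that its label lies in the label set shared by y
      and its image. For x of rank 2, both sides are false.\<close>
    have "f x \<in> covered_set P' (f y) \<longleftrightarrow> x \<in> covered_set P y" if y2: "y \<in> rank_level P 2"
    proof (cases "x \<in> rank_level P 1")
      case True
      have "x \<in> covered_set P y \<longleftrightarrow> l x \<in> P.labels l y"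
        using P.label_in_labels_iff[OF P(2) True y2] by simp
      also have "\<dots> \<longleftrightarrow> l' (f x) \<in> P'.labels l' (f y)"
        using h(2)[OF y2] j(2)[OF True] f1[OF True] f2[OF y2] by simp
      also have "\<dots> \<longleftrightarrow> f x \<in> covered_set P' (f y)"
        using P'.label_in_labels_iff[OF P'(2) f1'[OF True] f2'[OF y2]] .
      finally show ?thesis by simp
    next
      case False
      then have "x \<in> rank_level P 2" using fx by blast
      then have "f x \<notin> rank_level P' 1" using f2' disj' by blast
      then show ?thesis
        using False P.covered_level_2[OF y2] P'.covered_level_2[OF f2'[OF y2]] by blast
    qed
    then show ?thesis
      unfolding P(3) P'(3) P.Q_iff P'.Q_iff using inj level[OF y] fx by blast
  qed
  then have "iso Q Q' f" using bij by (simp add: iso_iff2)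
  moreover have "\<forall>a\<in>minimals Q. l' (f a) = l a"
    unfolding P(3) P.minimals_Q using f1 j(2) by simp
  ultimately show ?thesis using Q Q' by (auto simp: labelled_iso_def)
qed

lemma labelled_iso_imp_same_hypergraph:
  assumes "((Q, l), (Q', l')) \<in> labelled_iso r"
  shows "associated_hypergraph Q l = associated_hypergraph Q' l'"
proof -
  obtain f where f: "(Q, l) \<in> labelled_subposets r" "iso Q Q' f" "\<And>a. a \<in> minimals Q \<Longrightarrow> l' (f a) = l a"
    using assms by (auto simp: labelled_iso_def)
  then show ?thesis using labelled_iso_hypergraph[OF f(1,2), of l' "\<lambda>x. x"] by simp
qed

text \<open>On \<open>labelled_subposets r\<close> the relation is thus the kernel of the hypergraph
  map: it is an equivalence, and the hypergraph separates its classes.\<close>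

lemma labelled_iso_iff:
  fixes X Y :: "'a rel \<times> ('a \<Rightarrow> nat)"
  shows "(X, Y) \<in> labelled_iso r \<longleftrightarrow> X \<in> labelled_subposets r \<and> Y \<in> labelled_subposets r \<and>
     (\<lambda>(Q, l). associated_hypergraph Q l) X = (\<lambda>(Q, l). associated_hypergraph Q l) Y"
proof -
  obtain Q l Q' l' where "X = (Q, l)" "Y = (Q', l')" by (metis surj_pair)
  moreover have "(Q, l) \<in> labelled_subposets r \<and> (Q', l') \<in> labelled_subposets r"
    if "((Q, l), (Q', l')) \<in> labelled_iso r"
    using that by (auto simp: labelled_iso_def)
  ultimately show ?thesis
    using same_hypergraph_iso labelled_iso_imp_same_hypergraph by (simp, blast)
qed

lemma equiv_labelled_iso:
  "equiv (labelled_subposets r :: ('a rel \<times> ('a \<Rightarrow> nat)) set) (labelled_iso r)"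
  by (intro equivI refl_onI symI transI) (auto simp: labelled_iso_iff)

text \<open>An isomorphism maps minimal elements to minimal elements and so induces a permutation of
  the labels. Conversely, relabelling Q by \<pi> makes the hypergraphs equal, and
  \<open>same_hypergraph_iso\<close> applies.\<close>

lemma iso_iff_hypergraph:
  fixes Q Q' :: "'a rel"
  assumes Q: "(Q, l) \<in> labelled_subposets r" and Q': "(Q', l') \<in> labelled_subposets r"
  shows "(\<exists>f. iso Q Q' f) \<longleftrightarrow>
    (\<exists>\<pi>. bij_betw \<pi> {1..r} {1..r} \<and>
      associated_hypergraph Q' l' = (\<lambda>F. \<pi> ` F) ` associated_hypergraph Q l)"
proof
  assume "\<exists>f. iso Q Q' f"
  then obtain f where f: "iso Q Q' f" by blast
  let ?g = "inv_into (minimals Q) l"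
  have l: "bij_betw l (minimals Q) {1..r}" and l': "bij_betw l' (minimals Q') {1..r}"
    using labelled_bij_minimals Q Q' by blast+
  have "bij_betw f (minimals Q) (minimals Q')"
  proof (rule bij_betw_imageI)
    have inj: "inj_on f (Field Q)" and surj: "f ` Field Q = Field Q'"
      using f by (auto simp: iso_iff2 bij_betw_def)
    show "inj_on f (minimals Q)" by (rule inj_on_subset[OF inj]) (auto simp: minimals_def)
    show "f ` minimals Q = minimals Q'"
    proof
      show "f ` minimals Q \<subseteq> minimals Q'" using iso_minimals[OF f] by blast
      show "minimals Q' \<subseteq> f ` minimals Q"
      proof
        fix b assume b: "b \<in> minimals Q'"
        then have "inv_into (Field Q) f b \<in> minimals Q" by (rule iso_minimals[OF iso_inv_into[OF f]])
        moreover have "f (inv_into (Field Q) f b) = b"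
          using b surj by (intro f_inv_into_f) (simp add: minimals_def)
        ultimately show "b \<in> f ` minimals Q" by (rule rev_image_eqI[OF _ sym])
      qed
    qed
  qed
  then have "bij_betw (l' \<circ> f \<circ> ?g) {1..r} {1..r}"
    using bij_betw_trans[OF bij_betw_inv_into[OF l] bij_betw_trans[OF _ l']] by (simp add: comp_assoc)
  moreover have "l' (f a) = (l' \<circ> f \<circ> ?g) (l a)" if "a \<in> minimals Q" for a
    using l that by (simp add: bij_betw_def)
  ultimately show "\<exists>\<pi>. bij_betw \<pi> {1..r} {1..r} \<and>
      associated_hypergraph Q' l' = (\<lambda>F. \<pi> ` F) ` associated_hypergraph Q l"
    using labelled_iso_hypergraph[OF Q f] by blast
next
  assume "\<exists>\<pi>. bij_betw \<pi> {1..r} {1..r} \<and>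
      associated_hypergraph Q' l' = (\<lambda>F. \<pi> ` F) ` associated_hypergraph Q l"
  then obtain \<pi> where \<pi>: "bij_betw \<pi> {1..r} {1..r}"
    "associated_hypergraph Q (\<pi> \<circ> l) = associated_hypergraph Q' l'"
    by (auto simp: associated_hypergraph_image)
  have "((Q, \<pi> \<circ> l), (Q', l')) \<in> labelled_iso r"
    by (rule same_hypergraph_iso[OF labelled_relabel[OF Q \<pi>(1)] Q' \<pi>(2)])
  then show "\<exists>f. iso Q Q' f" by (auto simp: labelled_iso_def)
qed

section \<open>Posets from covering relations\<close>

text \<open>A graded poset given by its levels and Hasse diagram. It is instantiated by Wagner's
  extension, by its copy in another type and by the Fibonacci poset. Common covers are compared
  within one level only, because elements of different levels share no neighbour on either
  side.\<close>

locale cover_data =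
  fixes r :: nat and L :: "nat \<Rightarrow> 'a set" and C :: "'a rel"
  assumes level_unique: "x \<in> L m \<Longrightarrow> x \<in> L n \<Longrightarrow> m = n"
    and C_level: "(x, y) \<in> C \<Longrightarrow> \<exists>n. x \<in> L n \<and> y \<in> L (Suc n)"
    and L_0: "\<exists>z. L 0 = {z}"
    and ex_below: "y \<in> L (Suc n) \<Longrightarrow> \<exists>x. (x, y) \<in> C"
    and finite_L: "finite (L n)"
    and card_up: "x \<in> L n \<Longrightarrow> card (C `` {x}) = card (C\<inverse> `` {x}) + r"
    and card_common: "x \<in> L n \<Longrightarrow> y \<in> L n \<Longrightarrow> x \<noteq> y \<Longrightarrow>
      card (C `` {x} \<inter> C `` {y}) = card (C\<inverse> `` {x} \<inter> C\<inverse> `` {y})"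
begin

text \<open>The closure \<open>C\<^sup>*\<close> is reflexive on the whole type; the restriction
  cuts the field down to the levels.\<close>

definition poset :: "'a rel" where "poset = Restr (C\<^sup>*) (\<Union>n. L n)"

definition level :: "'a \<Rightarrow> nat" where "level x = (THE n. x \<in> L n)"

lemma level_eq: "x \<in> L n \<Longrightarrow> level x = n"
  unfolding level_def using level_unique by (intro the_equality)

lemma rtrancl_level:
  assumes "(x, y) \<in> C\<^sup>*" "x \<in> L m"
  shows "x = y \<or> (\<exists>n>m. y \<in> L n)"
  using assms
proof (induction rule: rtrancl_induct)
  case (step y z)
  obtain k where k: "y \<in> L k" "z \<in> L (Suc k)" using C_level[OF step.hyps(2)] by blast
  have "m \<le> k" using step.IH[OF step.prems] k(1) level_unique step.prems by fastforce
  then show ?case using k(2) by (meson le_imp_less_Suc)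
qed simp

lemma poset_level: "(x, y) \<in> poset \<Longrightarrow> x = y \<or> level x < level y"
proof -
  assume "(x, y) \<in> poset"
  then obtain m where "(x, y) \<in> C\<^sup>*" "x \<in> L m" by (auto simp: poset_def)
  then show ?thesis using rtrancl_level[of x y m] by (auto simp: level_eq)
qed

lemma Field_poset: "Field poset = (\<Union>n. L n)"
  by (auto simp: poset_def Field_def)

lemma covers_poset: "covers poset y x \<longleftrightarrow> (x, y) \<in> C"
proof
  assume xy: "(x, y) \<in> C"
  then obtain n where n: "x \<in> L n" "y \<in> L (Suc n)" using C_level by blast
  have "z = x \<or> z = y" if "(x, z) \<in> poset" "(z, y) \<in> poset" for z
    using poset_level[OF that(1)] poset_level[OF that(2)] n by (auto simp: level_eq)
  moreover have "(x, y) \<in> poset" using xy n by (auto simp: poset_def)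
  moreover have "x \<noteq> y" using n level_unique[of x n "Suc n"] by auto
  ultimately show "covers poset y x" by (auto simp: covers_def)
next
  assume c: "covers poset y x"
  then have "(x, y) \<in> C\<^sup>*" "x \<noteq> y" by (auto simp: covers_def poset_def)
  \<comment> \<open>The first step of a chain from x to y ends between them and above x, so it ends
    at y when y covers x.\<close>
  then obtain z where z: "(x, z) \<in> C" "(z, y) \<in> C\<^sup>*" by (meson converse_rtranclE)
  then obtain n where n: "x \<in> L n" "z \<in> L (Suc n)" using C_level by blast
  then have "(x, z) \<in> poset" "(z, y) \<in> poset" "z \<noteq> x"
    using z c level_unique[of x n "Suc n"] by (auto simp: poset_def covers_def)
  then have "z = y" using c by (auto simp: covers_def)
  then show "(x, y) \<in> C" using z by simp
qed

sublocale graded_poset poset level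
proof
  have "refl_on (Field poset) poset" unfolding Field_poset by (auto simp: poset_def intro!: refl_onI)
  moreover have "trans poset" unfolding poset_def by (auto intro!: transI intro: rtrancl_trans)
  moreover have "antisym poset"
  proof (rule antisymI)
    show "x = y" if "(x, y) \<in> poset" "(y, x) \<in> poset" for x y
      using poset_level[OF that(1)] poset_level[OF that(2)] by auto
  qed
  moreover have "poset \<subseteq> Field poset \<times> Field poset" by (auto simp: Field_def)
  ultimately show "Partial_order poset"
    by (simp add: partial_order_on_def preorder_on_def)
  show "locally_finite poset"
    unfolding locally_finite_def
  proof (intro allI)
    fix x y
    \<comment> \<open>Everything below y lies in the finitely many finite levels up to that of
      y.\<close>
    have "{z. (x, z) \<in> poset \<and> (z, y) \<in> poset} \<subseteq> (\<Union>n\<in>{..level y}. L n)"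
    proof
      fix z assume z: "z \<in> {z. (x, z) \<in> poset \<and> (z, y) \<in> poset}"
      then obtain n where "z \<in> L n" by (auto simp: poset_def)
      moreover have "level z \<le> level y" using z poset_level[of z y] by auto
      ultimately show "z \<in> (\<Union>n\<in>{..level y}. L n)" by (auto simp: level_eq)
    qed
    then show "finite {z. (x, z) \<in> poset \<and> (z, y) \<in> poset}"
      by (rule finite_subset) (simp add: finite_L)
  qed
  have "level x = 0" if x: "x \<in> minimals poset" for x
  proof (rule ccontr)
    assume "level x \<noteq> 0"
    moreover obtain n where n: "x \<in> L n" using x by (auto simp: minimals_def Field_poset)
    ultimately obtain m where "x \<in> L (Suc m)" by (metis level_eq not0_implies_Suc)
    then obtain y where "(y, x) \<in> C" using ex_below by blast
    then have "covers poset x y" by (simp add: covers_poset)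
    then show False using x by (auto simp: minimals_def covers_def)
  qed
  moreover have "level y = Suc (level x)" if "covers poset y x" for x y
    using that C_level by (auto simp: covers_poset level_eq dest!: C_level)
  ultimately show "rank_function poset level" by (simp add: rank_function_def)
qed

lemma rank_level_poset: "rank_level poset n = L n"
  using rank_level level_eq by (auto simp: Field_poset)

lemma covered_set_poset: "covered_set poset x = C\<inverse> `` {x}"
  by (auto simp: covered_set_def covers_poset)

lemma covering_set_poset: "covering_set poset x = C `` {x}"
  by (auto simp: covering_set_def covers_poset)

lemma differential_poset: "differential_poset r poset"
proof (rule differential_posetI)
  show "\<exists>!x. x \<in> Field poset \<and> level x = 0"
  proof -
    obtain z where z: "L 0 = {z}" using L_0 by blast
    show ?thesis
    proof (rule ex1I)
      show "z \<in> Field poset \<and> level z = 0" using z level_eq[of z 0] unfolding Field_poset by blast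
      fix x assume "x \<in> Field poset \<and> level x = 0"
      then have "x \<in> L 0" unfolding Field_poset using level_eq by fastforce
      then show "x = z" using z by simp
    qed
  qed
  \<comment> \<open>At level 0 the difference truncates harmlessly, since nothing lies below x
    there.\<close>
  have "y \<in> L (level x - 1)" if "(y, x) \<in> C" for x y
    using C_level[OF that] by (auto simp: level_eq)
  then have down: "C\<inverse> `` {x} \<subseteq> L (level x - 1)" for x by blast
  have "y \<in> L (Suc (level x))" if "(x, y) \<in> C" for x y
    using C_level[OF that] by (auto simp: level_eq)
  then have up: "C `` {x} \<subseteq> L (Suc (level x))" for x by blast
  show fin: "finite (covered_set poset x)" "finite (covering_set poset x)" for x
    unfolding covered_set_poset covering_set_poset
    using finite_subset[OF down finite_L] finite_subset[OF up finite_L] by blast+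
  show "card (covering_set poset x) = card (covered_set poset x) + r" if "x \<in> Field poset" for x
    using that card_up by (auto simp: Field_poset covered_set_poset covering_set_poset)
  show "card (covered_set poset x \<inter> covered_set poset y) = card (covering_set poset x \<inter> covering_set poset y)"
    if xy: "x \<in> Field poset" "y \<in> Field poset" "x \<noteq> y" for x y
  proof -
    obtain m n where mn: "x \<in> L m" "y \<in> L n" using xy unfolding Field_poset by blast
    show ?thesis
    proof (cases "m = n")
      case True
      then show ?thesis using card_common mn xy by (simp add: covered_set_poset covering_set_poset)
    next
      case False
      have "covered_set poset x \<inter> covered_set poset y = {}"
        using mn False covers_rank[of x] covers_rank[of y]
        by (force simp: covered_set_def level_eq)
      moreover have "covering_set poset x \<inter> covering_set poset y = {}"
        using mn False covers_rank[of _ x] covers_rank[of _ y]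
        by (force simp: covering_set_def level_eq)
      ultimately show ?thesis by simp
    qed
  qed
qed

end

text \<open>Transport of structure along an injection on the levels; it moves the extension from its
  datatype into the type over which the classification is stated.\<close>

lemma cover_data_image:
  assumes "cover_data r L C" and inj: "inj_on g (\<Union>n. L n)"
  shows "cover_data r (\<lambda>n. g ` L n) (map_prod g g ` C)"
proof -
  interpret cover_data r L C by (rule assms(1))
  let ?C = "map_prod g g ` C"
  have Field: "x \<in> (\<Union>n. L n) \<and> y \<in> (\<Union>n. L n)" if "(x, y) \<in> C" for x y
    using C_level[OF that] by blast
  have eq: "g x = g y \<longleftrightarrow> x = y" if "x \<in> (\<Union>n. L n)" "y \<in> (\<Union>n. L n)" for x y
    using inj that by (auto simp: inj_on_def)
  have up: "?C `` {g x} = g ` (C `` {x})" and down: "?C\<inverse> `` {g x} = g ` (C\<inverse> `` {x})"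
    if x: "x \<in> (\<Union>n. L n)" for x
  proof -
    show "?C `` {g x} = g ` (C `` {x})"
    proof
      show "?C `` {g x} \<subseteq> g ` (C `` {x})"
      proof
        fix z assume "z \<in> ?C `` {g x}"
        then obtain a b where "(a, b) \<in> C" "g x = g a" "z = g b" by auto
        then show "z \<in> g ` (C `` {x})" using eq[OF x, of a] Field by blast
      qed
    qed auto
    show "?C\<inverse> `` {g x} = g ` (C\<inverse> `` {x})"
    proof
      show "?C\<inverse> `` {g x} \<subseteq> g ` (C\<inverse> `` {x})"
      proof
        fix z assume "z \<in> ?C\<inverse> `` {g x}"
        then obtain a b where "(a, b) \<in> C" "g x = g b" "z = g a" by auto
        then show "z \<in> g ` (C\<inverse> `` {x})" using eq[OF x, of b] Field by blast
      qed
    qed auto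
  qed
  have card: "card (g ` S) = card S" if "S \<subseteq> (\<Union>n. L n)" for S
    using inj_on_subset[OF inj that] by (rule card_image)
  have sub: "C `` {x} \<subseteq> (\<Union>n. L n)" "C\<inverse> `` {x} \<subseteq> (\<Union>n. L n)" for x
    using Field by blast+
  show ?thesis
  proof
    show "m = n" if "x \<in> g ` L m" "x \<in> g ` L n" for x m n
    proof -
      obtain a b where ab: "a \<in> L m" "b \<in> L n" "x = g a" "x = g b" using \<open>x \<in> g ` L m\<close> \<open>x \<in> g ` L n\<close> by blast
      then have "a = b" using eq[of a b] by auto
      then show "m = n" using ab level_unique by simp
    qed
    show "\<exists>n. x \<in> g ` L n \<and> y \<in> g ` L (Suc n)" if "(x, y) \<in> ?C" for x y
      using that by (auto dest!: C_level)
    show "\<exists>z. g ` L 0 = {z}" using L_0 by auto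
    show "\<exists>x. (x, y) \<in> ?C" if "y \<in> g ` L (Suc n)" for y n
    proof -
      obtain b where b: "b \<in> L (Suc n)" "y = g b" using \<open>y \<in> g ` L (Suc n)\<close> by blast
      then obtain a where "(a, b) \<in> C" using ex_below by blast
      then have "(g a, y) \<in> ?C" using b by force
      then show "\<exists>x. (x, y) \<in> ?C" ..
    qed
    show "finite (g ` L n)" for n by (simp add: finite_L)
    show "card (?C `` {x}) = card (?C\<inverse> `` {x}) + r" if "x \<in> g ` L n" for x n
    proof -
      obtain a where a: "a \<in> L n" "x = g a" using \<open>x \<in> g ` L n\<close> by blast
      then have "a \<in> (\<Union>n. L n)" by blast
      then show ?thesis unfolding a(2) using up[of a] down[of a] card[OF sub(1)[of a]] card[OF sub(2)[of a]] card_up[OF a(1)] by simp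
    qed
    show "card (?C `` {x} \<inter> ?C `` {y}) = card (?C\<inverse> `` {x} \<inter> ?C\<inverse> `` {y})"
      if "x \<in> g ` L n" "y \<in> g ` L n" "x \<noteq> y" for x y n
    proof -
      obtain a b where ab: "a \<in> L n" "b \<in> L n" "x = g a" "y = g b"
        using \<open>x \<in> g ` L n\<close> \<open>y \<in> g ` L n\<close> by blast
      then have F: "a \<in> (\<Union>n. L n)" "b \<in> (\<Union>n. L n)" by blast+
      have "?C `` {x} \<inter> ?C `` {y} = g ` (C `` {a} \<inter> C `` {b})"
        unfolding ab up[OF F(1)] up[OF F(2)] by (rule inj_on_image_Int[OF inj sub(1) sub(1), symmetric])
      moreover have "?C\<inverse> `` {x} \<inter> ?C\<inverse> `` {y} = g ` (C\<inverse> `` {a} \<inter> C\<inverse> `` {b})"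
        unfolding ab down[OF F(1)] down[OF F(2)] by (rule inj_on_image_Int[OF inj sub(2) sub(2), symmetric])
      moreover have "a \<noteq> b" using \<open>x \<noteq> y\<close> ab by blast
      ultimately show ?thesis
        using card_common[OF ab(1,2)] card[of "C `` {a} \<inter> C `` {b}"] card[of "C\<inverse> `` {a} \<inter> C\<inverse> `` {b}"] sub
        by (metis le_infI1)
    qed
  qed
qed

text \<open>Here D stands for the lower covers of an element and U for its upper covers: a
  reflection \<open>R y\<close> for each y in D, and r new elements. The constructors are kept
  abstract to serve both extensions below.\<close>

lemma card_reflection:
  assumes "U = R ` D \<union> N ` {..<r}" "finite D" "inj R" "inj N" "\<And>y i. R y \<noteq> N i"
  shows "card U = card D + (r::nat)"
proof -
  have "card U = card (R ` D) + card (N ` {..<r})"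
    unfolding assms(1) using assms(2,5) by (intro card_Un_disjoint) auto
  also have "\<dots> = card D + r"
    using assms(3,4) by (simp add: card_image inj_on_subset)
  finally show ?thesis .
qed

text \<open>A new element lies above one element only, so two distinct elements share exactly the
  reflections of their common lower covers.\<close>

lemma card_reflection_common:
  assumes "U = R ` D \<union> N ` {..<r}" "U' = R ` D' \<union> N' ` {..<r::nat}" "inj R"
    "\<And>y i. R y \<noteq> N i" "\<And>y i. R y \<noteq> N' i" "\<And>i j. N i \<noteq> N' j"
  shows "card (U \<inter> U') = card (D \<inter> D')"
proof -
  have "U \<inter> U' = R ` D \<inter> R ` D'"
    unfolding assms(1,2) using assms(4,5,6) by (auto simp: image_iff) (metis assms(4,5,6))+
  also have "\<dots> = R ` (D \<inter> D')" by (rule image_Int[OF assms(3), symmetric])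
  finally show ?thesis using assms(3) by (simp add: card_image inj_on_subset)
qed

text \<open>Wagner's reflection extension of a poset with ranks 0 to 2, where \<open>Base b\<close> covers the atoms in
  \<open>k b\<close>.\<close>

datatype 'b wagner = Bot | Atom nat | Base 'b | Refl "'b wagner" | New "'b wagner" nat

fun wagner_level :: "nat \<Rightarrow> 'b set \<Rightarrow> nat \<Rightarrow> 'b wagner set" where
  "wagner_level r B 0 = {Bot}"
| "wagner_level r B (Suc 0) = Atom ` {1..r}"
| "wagner_level r B (Suc (Suc 0)) = Base ` B"
| "wagner_level r B (Suc (Suc (Suc j))) = Refl ` wagner_level r B (Suc j) \<union>
     {New x i | x i. x \<in> wagner_level r B (Suc (Suc j)) \<and> i < r}"

text \<open>The level conditions in \<open>new\<close> and \<open>reflect\<close> let the extension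
  start at rank 3: rank 2 is prescribed by B, so \<open>Bot\<close> is not reflected and atoms
  receive no new elements.\<close>

inductive_set wagner_covers :: "nat \<Rightarrow> 'b set \<Rightarrow> ('b \<Rightarrow> nat set) \<Rightarrow> 'b wagner rel"
  for r :: nat and B :: "'b set" and k :: "'b \<Rightarrow> nat set" where
  atom: "v \<in> {1..r} \<Longrightarrow> (Bot, Atom v) \<in> wagner_covers r B k"
| base: "b \<in> B \<Longrightarrow> v \<in> k b \<Longrightarrow> (Atom v, Base b) \<in> wagner_covers r B k"
| new: "x \<in> wagner_level r B (Suc (Suc n)) \<Longrightarrow> i < r \<Longrightarrow> (x, New x i) \<in> wagner_covers r B k"
| reflect: "(y, x) \<in> wagner_covers r B k \<Longrightarrow> y \<in> wagner_level r B (Suc n) \<Longrightarrow>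
    (x, Refl y) \<in> wagner_covers r B k"

primrec wagner_rank :: "'b wagner \<Rightarrow> nat" where
  "wagner_rank Bot = 0"
| "wagner_rank (Atom v) = 1"
| "wagner_rank (Base b) = 2"
| "wagner_rank (Refl x) = Suc (Suc (wagner_rank x))"
| "wagner_rank (New x i) = Suc (wagner_rank x)"

lemma wagner_rank_level: "x \<in> wagner_level r B n \<Longrightarrow> wagner_rank x = n"
  by (induction r B n arbitrary: x rule: wagner_level.induct) auto

text \<open>The conditions at ranks 0 and 1 come from the number of atoms and the incidence axioms;
  from rank 2 on, the reflection counts apply whatever the shape below.\<close>

lemma (in incidence) wagner_cover_data:
  assumes r: "0 < r"
  shows "cover_data r (wagner_level r B) (wagner_covers r B k)"
proof -
  let ?L = "wagner_level r B" and ?C = "wagner_covers r B k"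
  have C_level: "\<exists>n. x \<in> ?L n \<and> y \<in> ?L (Suc n)" if "(x, y) \<in> ?C" for x y
    using that
  proof induction
    case (atom v)
    then show ?case by (intro exI[of _ 0]) simp
  next
    case (base b v)
    then have "v \<in> {1..r}" using k_sub by blast
    then show ?case using base by (intro exI[of _ 1]) simp
  next
    case (new x n i)
    then show ?case by (intro exI[of _ "Suc (Suc n)"]) auto
  next
    case (reflect y x n)
    then obtain m where m: "y \<in> ?L m" "x \<in> ?L (Suc m)" by blast
    then have "m = Suc n" using wagner_rank_level reflect.hyps(2) by blast
    then show ?case using m by (intro exI[of _ "Suc (Suc n)"]) auto
  qed
  have fin: "finite (?L n)" for n
    using finite_B
  proof (induction r B n rule: wagner_level.induct)
    case (4 r B j)
    have "{New x i |x i. x \<in> wagner_level r B (Suc (Suc j)) \<and> i < r} =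
        (\<lambda>(x, i). New x i) ` (wagner_level r B (Suc (Suc j)) \<times> {..<r})" by auto
    then show ?case using 4 by simp
  qed auto
  have rank: "wagner_rank y = Suc (wagner_rank x)" if "(x, y) \<in> ?C" for x y
    using C_level[OF that] wagner_rank_level by blast
  have Bot_up: "?C `` {Bot} = Atom ` {1..r}"
    by (auto elim!: wagner_covers.cases intro: wagner_covers.intros dest: wagner_rank_level rank)
  have Bot_down: "?C\<inverse> `` {Bot} = {}" using rank by fastforce
  have Atom_down: "?C\<inverse> `` {Atom v} = {Bot}" if "v \<in> {1..r}" for v
    using that by (auto elim: wagner_covers.cases intro: wagner_covers.intros)
  have Atom_up: "?C `` {Atom v} = Base ` {b \<in> B. v \<in> k b}" for v
  proof -
    have "z \<in> Base ` {b \<in> B. v \<in> k b}" if "(Atom v, z) \<in> ?C" for z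
      using that
    proof cases
      case (new n i)
      then show ?thesis using wagner_rank_level[OF new(2)] by simp
    next
      case (reflect y n)
      then show ?thesis using wagner_rank_level[OF reflect(3)] rank[OF reflect(2)] by simp
    qed auto
    then show ?thesis by (auto intro: wagner_covers.intros)
  qed
  have up: "?C `` {x} = Refl ` (?C\<inverse> `` {x}) \<union> New x ` {..<r}" if x: "x \<in> ?L (Suc (Suc n))" for x n
  proof
    show "?C `` {x} \<subseteq> Refl ` (?C\<inverse> `` {x}) \<union> New x ` {..<r}"
    proof
      fix z assume "z \<in> ?C `` {x}"
      then have "(x, z) \<in> ?C" by simp
      then show "z \<in> Refl ` (?C\<inverse> `` {x}) \<union> New x ` {..<r}"
        by cases (use wagner_rank_level[OF x] in auto)
    qed
    show "Refl ` (?C\<inverse> `` {x}) \<union> New x ` {..<r} \<subseteq> ?C `` {x}"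
    proof -
      have "(x, Refl y) \<in> ?C" if y: "(y, x) \<in> ?C" for y
      proof -
        obtain m where "y \<in> ?L m" using C_level[OF y] by blast
        moreover from this have "m = Suc n"
          using wagner_rank_level[OF x] rank[OF y] wagner_rank_level by fastforce
        ultimately show ?thesis using wagner_covers.reflect[OF y, of n] by simp
      qed
      then show ?thesis using x by (auto intro: wagner_covers.new)
    qed
  qed
  have down_fin: "finite (?C\<inverse> `` {x})" for x
  proof (rule finite_subset)
    show "?C\<inverse> `` {x} \<subseteq> ?L (wagner_rank x - 1)"
      using C_level wagner_rank_level rank by fastforce
  qed (rule fin)
  show ?thesis
  proof
    show "m = n" if "x \<in> ?L m" "x \<in> ?L n" for x m n
      using wagner_rank_level[OF that(1)] wagner_rank_level[OF that(2)] by simp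
    show "\<exists>n. x \<in> ?L n \<and> y \<in> ?L (Suc n)" if "(x, y) \<in> ?C" for x y
      by (rule C_level[OF that])
    show "\<exists>z. ?L 0 = {z}" by simp
    show "finite (?L n)" for n by (rule fin)
    show "\<exists>x. (x, y) \<in> ?C" if y: "y \<in> ?L (Suc n)" for y n
    proof -
      consider "n = 0" | "n = Suc 0" | j where "n = Suc (Suc j)" by (metis not0_implies_Suc)
      then show ?thesis
      proof cases
        case 1
        then obtain v where "v \<in> {1..r}" "y = Atom v" using y by auto
        then show ?thesis by (blast intro: wagner_covers.atom)
      next
        case 2
        then obtain b where "b \<in> B" "y = Base b" using y by auto
        then show ?thesis using k_sub by (blast intro: wagner_covers.base)
      next
        case (3 j)
        show ?thesis
        proof (cases "\<exists>x i. y = New x i \<and> x \<in> ?L (Suc (Suc j)) \<and> i < r")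
          case True
          then show ?thesis by (blast intro: wagner_covers.new)
        next
          case False
          then obtain x where x: "x \<in> ?L (Suc j)" "y = Refl x" using y 3 by auto
          \<comment> \<open>The lower covers of \<open>Refl x\<close> are the upper covers of x, so
            one must exist: for an atom by its degree r + 1, higher up because 0 < r provides a new
            element.\<close>
          have "\<exists>z. (x, z) \<in> ?C"
          proof (cases j)
            case 0
            then obtain v where v: "v \<in> {1..r}" "x = Atom v" using x by auto
            then have "{b \<in> B. v \<in> k b} \<noteq> {}" using degree[of v] by fastforce
            then show ?thesis using v by (blast intro: wagner_covers.base)
          next
            case (Suc i)
            then show ?thesis using x r by (blast intro: wagner_covers.new)
          qed
          then show ?thesis using x by (blast intro: wagner_covers.reflect)
        qed
      qed
    qed
    show "card (?C `` {x}) = card (?C\<inverse> `` {x}) + r" if x: "x \<in> ?L n" for x n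
    proof -
      consider "n = 0" | "n = Suc 0" | j where "n = Suc (Suc j)" by (metis not0_implies_Suc)
      then show ?thesis
      proof cases
        case 1
        then have "x = Bot" using x by simp
        then show ?thesis unfolding \<open>x = Bot\<close> Bot_up Bot_down by (simp add: card_image inj_on_def)
      next
        case 2
        then obtain v where v: "v \<in> {1..r}" "x = Atom v" using x by auto
        then show ?thesis unfolding v(2) Atom_up Atom_down[OF v(1)] using degree by (simp add: card_image inj_on_def)
      next
        case (3 j)
        then show ?thesis
          using x by (intro card_reflection[OF up down_fin]) (auto intro: injI)
      qed
    qed
    show "card (?C `` {x} \<inter> ?C `` {y}) = card (?C\<inverse> `` {x} \<inter> ?C\<inverse> `` {y})"
      if x: "x \<in> ?L n" and y: "y \<in> ?L n" and "x \<noteq> y" for x y n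
    proof -
      consider "n = 0" | "n = Suc 0" | j where "n = Suc (Suc j)" by (metis not0_implies_Suc)
      then show ?thesis
      proof cases
        case 1
        then show ?thesis using x y \<open>x \<noteq> y\<close> by simp
      next
        case 2
        then obtain v w where vw: "v \<in> {1..r}" "x = Atom v" "w \<in> {1..r}" "y = Atom w" using x y by auto
        have "Base ` {b \<in> B. v \<in> k b} \<inter> Base ` {b \<in> B. w \<in> k b} = Base ` {b \<in> B. v \<in> k b \<and> w \<in> k b}"
          by auto
        then show ?thesis
          unfolding vw(2,4) Atom_up Atom_down[OF vw(1)] Atom_down[OF vw(3)]
          using pair[OF vw(1,3)] vw \<open>x \<noteq> y\<close> by (simp add: card_image inj_on_def)
      next
        case (3 j)
        then show ?thesis
          using x y \<open>x \<noteq> y\<close> by (intro card_reflection_common[OF up up]) (auto intro: injI)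
      qed
    qed
  qed
qed

section \<open>Realization inside an arbitrary infinite type\<close>

lemma ex_inj_on_infinite:
  assumes "countable S" "infinite (UNIV :: 'a set)"
  obtains g :: "'b \<Rightarrow> 'a" where "inj_on g S"
proof -
  obtain h :: "nat \<Rightarrow> 'a" where "inj h" using infinite_countable_subset[OF assms(2)] by blast
  then have "inj_on (h \<circ> to_nat_on S) S"
    using inj_on_to_nat_on[OF assms(1)] by (intro comp_inj_on) (auto intro: inj_on_subset)
  then show ?thesis by (rule that)
qed

text \<open>This is surjectivity of the classification: the incidence structure of E is extended by
  reflection, and its countable set of elements is injected into the given type.\<close>

lemma ex_differential_hypergraph:
  assumes r: "0 < r" and inf: "infinite (UNIV :: 'a set)" and E: "E \<in> pair_covering_hypergraphs r"
  obtains P :: "'a rel" and l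
  where "differential r P" "labelling r P l" "associated_hypergraph (rank_selected P {1, 2}) l = E"
proof -
  obtain B :: "(nat set \<times> nat) set" where inc: "incidence r B fst" and edges: "incidence_edges B fst = E"
    by (rule ex_incidence[OF E])
  interpret incidence r B fst by (rule inc)
  let ?L = "wagner_level r B" and ?C = "wagner_covers r B fst"
  interpret W: cover_data r ?L ?C by (rule wagner_cover_data[OF r])
  have "countable (\<Union>n. ?L n)" by (intro countable_UN) (auto intro: countable_finite W.finite_L)
  then obtain g :: "(nat set \<times> nat) wagner \<Rightarrow> 'a" where g: "inj_on g (\<Union>n. ?L n)"
    by (rule ex_inj_on_infinite[OF _ inf])
  interpret G: cover_data r "\<lambda>n. g ` ?L n" "map_prod g g ` ?C"
    by (rule cover_data_image[OF W.cover_data_axioms g])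
  interpret D: differential r G.poset by unfold_locales (rule G.differential_poset)
  have level_1: "rank_level G.poset 1 = (\<lambda>v. g (Atom v)) ` {1..r}"
    unfolding G.rank_level_poset by (simp add: image_image)
  have level_2: "rank_level G.poset 2 = (\<lambda>b. g (Base b)) ` B"
    unfolding G.rank_level_poset by (simp add: image_image numeral_2_eq_2)
  have Atom_L: "Atom v \<in> (\<Union>n. ?L n)" if "v \<in> {1..r}" for v
    using that by (intro UN_I[of 1]) auto
  have Base_L: "Base b \<in> (\<Union>n. ?L n)" if "b \<in> B" for b
    using that by (intro UN_I[of "Suc (Suc 0)"]) auto
  \<comment> \<open>Inverting the naming of the atoms gives \<open>g (Base b)\<close> the label set
    \<open>fst b\<close>.\<close>
  define l where "l = inv_into {1..r} (\<lambda>v. g (Atom v))"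
  have inj: "inj_on (\<lambda>v. g (Atom v)) {1..r}"
  proof (rule inj_onI)
    fix v w assume "v \<in> {1..r}" "w \<in> {1..r}" "g (Atom v) = g (Atom w)"
    then show "v = w" using inj_onD[OF g _ Atom_L Atom_L, of v w] by simp
  qed
  have lab: "labelling r G.poset l"
    unfolding labelling_def level_1 l_def
    by (rule bij_betw_inv_into) (rule inj_on_imp_bij_betw[OF inj])
  have labels: "D.labels l (g (Base b)) = fst b" if b: "b \<in> B" for b
  proof -
    have "covered_set G.poset (g (Base b)) = (\<lambda>v. g (Atom v)) ` fst b"
      unfolding G.covered_set_poset
    proof
      show "(map_prod g g ` ?C)\<inverse> `` {g (Base b)} \<subseteq> (\<lambda>v. g (Atom v)) ` fst b"
      proof
        fix x assume "x \<in> (map_prod g g ` ?C)\<inverse> `` {g (Base b)}"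
        then obtain a c where ac: "(a, c) \<in> ?C" "x = g a" "g (Base b) = g c" by auto
        moreover have "c \<in> (\<Union>n. ?L n)" using W.C_level[OF ac(1)] by blast
        ultimately have "(a, Base b) \<in> ?C" using inj_onD[OF g _ Base_L[OF b], of c] by simp
        then show "x \<in> (\<lambda>v. g (Atom v)) ` fst b" using ac(2) by cases auto
      qed
      show "(\<lambda>v. g (Atom v)) ` fst b \<subseteq> (map_prod g g ` ?C)\<inverse> `` {g (Base b)}"
      proof
        fix x assume "x \<in> (\<lambda>v. g (Atom v)) ` fst b"
        then obtain v where "v \<in> fst b" "x = g (Atom v)" by blast
        moreover from this have "(Atom v, Base b) \<in> ?C" using b by (blast intro: wagner_covers.base)
        ultimately show "x \<in> (map_prod g g ` ?C)\<inverse> `` {g (Base b)}" by force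
      qed
    qed
    moreover have "l (g (Atom v)) = v" if "v \<in> fst b" for v
      unfolding l_def using k_sub[OF b] that by (intro inv_into_f_f[OF inj]) blast
    ultimately show ?thesis by (simp add: D.labels_def image_image)
  qed
  have "associated_hypergraph (rank_selected G.poset {1, 2}) l = incidence_edges B fst"
  proof -
    have "incidence_edges ((\<lambda>b. g (Base b)) ` B) (D.labels l) =
        {D.labels l (g (Base b)) | b. b \<in> B \<and> 2 \<le> card (D.labels l (g (Base b)))}"
      unfolding incidence_edges_def by blast
    also have "\<dots> = incidence_edges B fst"
      unfolding incidence_edges_def using labels by (smt (verit) Collect_cong)
    finally show ?thesis unfolding D.associated_hypergraph_eq[OF lab] level_2 .
  qed
  then show ?thesis using that[OF D.differential_axioms lab] edges by simp
qed

text \<open>The Fibonacci poset is the reflection extension of a single point.\<close>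

primrec fib_rank :: "fib \<Rightarrow> nat" where
  "fib_rank Fib_Zero = 0"
| "fib_rank (Fib_Refl x) = Suc (Suc (fib_rank x))"
| "fib_rank (Fib_New x i) = Suc (fib_rank x)"

lemma fib_rank_level: "x \<in> fib_level r n \<Longrightarrow> fib_rank x = n"
  by (induction r n arbitrary: x rule: fib_level.induct) auto

lemma Fib_New_level: "x \<in> fib_level r n \<Longrightarrow> i < r \<Longrightarrow> Fib_New x i \<in> fib_level r (Suc n)"
  by (cases n) auto

lemma fib_covers_level: "(x, y) \<in> fib_covers r \<Longrightarrow> \<exists>n. x \<in> fib_level r n \<and> y \<in> fib_level r (Suc n)"
proof (induction rule: fib_covers.induct)
  case (reflect y x)
  then obtain n where "y \<in> fib_level r n" "x \<in> fib_level r (Suc n)" by blast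
  then show ?case by (intro exI[of _ "Suc n"]) simp
qed (use Fib_New_level in blast)

lemma finite_fib_level: "finite (fib_level r n)"
proof -
  have eq: "{Fib_New x i |x i. x \<in> A \<and> i < r} = (\<lambda>(x, i). Fib_New x i) ` (A \<times> {..<r})" for A r
    by auto
  show ?thesis
    by (induction r n rule: fib_level.induct) (simp_all only: fib_level.simps eq, simp_all)
qed

text \<open>Here the reflection shape is present from rank 0 on, so no low ranks need separate
  treatment.\<close>

lemma fib_covers_up:
  assumes "x \<in> fib_level r n"
  shows "fib_covers r `` {x} = Fib_Refl ` ((fib_covers r)\<inverse> `` {x}) \<union> Fib_New x ` {..<r}"
proof -
  have "z \<in> Fib_Refl ` ((fib_covers r)\<inverse> `` {x}) \<union> Fib_New x ` {..<r}" if "(x, z) \<in> fib_covers r" for z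
    using that by cases auto
  then show ?thesis using assms by (auto intro: fib_covers.intros)
qed

lemma fib_cover_data:
  assumes r: "0 < r"
  shows "cover_data r (fib_level r) (fib_covers r)"
proof
  let ?C = "fib_covers r"
  have fin: "finite (?C\<inverse> `` {x})" for x
  proof (rule finite_subset)
    show "?C\<inverse> `` {x} \<subseteq> fib_level r (fib_rank x - 1)"
    proof
      fix y assume "y \<in> ?C\<inverse> `` {x}"
      then obtain n where "y \<in> fib_level r n" "x \<in> fib_level r (Suc n)"
        using fib_covers_level by blast
      then show "y \<in> fib_level r (fib_rank x - 1)" using fib_rank_level by force
    qed
  qed (rule finite_fib_level)
  show "m = n" if "x \<in> fib_level r m" "x \<in> fib_level r n" for x m n
    using fib_rank_level[OF that(1)] fib_rank_level[OF that(2)] by simp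
  show "\<exists>n. x \<in> fib_level r n \<and> y \<in> fib_level r (Suc n)" if "(x, y) \<in> ?C" for x y
    by (rule fib_covers_level[OF that])
  show "\<exists>z. fib_level r 0 = {z}" by simp
  show "finite (fib_level r n)" for n by (rule finite_fib_level)
  show "\<exists>x. (x, y) \<in> ?C" if y: "y \<in> fib_level r (Suc n)" for y n
  proof (cases "\<exists>x i. y = Fib_New x i \<and> x \<in> fib_level r n \<and> i < r")
    case True
    then show ?thesis by (blast intro: fib_covers.new)
  next
    case False
    then obtain j x where "x \<in> fib_level r j" "y = Fib_Refl x" using y by (cases n) auto
    then show ?thesis using r by (blast intro: fib_covers.intros)
  qed
  show "card (?C `` {x}) = card (?C\<inverse> `` {x}) + r" if "x \<in> fib_level r n" for x n
    by (rule card_reflection[OF fib_covers_up[OF that] fin]) (auto intro: injI)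
  show "card (?C `` {x} \<inter> ?C `` {y}) = card (?C\<inverse> `` {x} \<inter> ?C\<inverse> `` {y})"
    if "x \<in> fib_level r n" "y \<in> fib_level r n" "x \<noteq> y" for x y n
    by (rule card_reflection_common[OF fib_covers_up[OF that(1)] fib_covers_up[OF that(2)]])
      (use that(3) in \<open>auto intro: injI\<close>)
qed

lemma fibonacci_differential: "0 < r \<Longrightarrow> differential r (fibonacci_poset r)"
  using cover_data.differential_poset[OF fib_cover_data]
  by (simp add: differential_def fibonacci_poset_def cover_data.poset_def[OF fib_cover_data])

text \<open>The reflection \<open>Fib_Refl Fib_Zero\<close> of the bottom covers all atoms. For r >
  1 it yields the full edge, which leaves only the simplex; for r = 1 it covers a single atom and
  yields no edge.\<close>

lemma fibonacci_hypergraph: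
  assumes r: "0 < r" and l: "labelling r (fibonacci_poset r) l"
  shows "associated_hypergraph (rank_selected (fibonacci_poset r) {1, 2}) l =
    (if r = 1 then {} else simplex_hypergraph r)"
proof -
  interpret F: cover_data r "fib_level r" "fib_covers r" by (rule fib_cover_data[OF r])
  interpret D: differential r "fibonacci_poset r" by (rule fibonacci_differential[OF r])
  have poset: "fibonacci_poset r = F.poset" by (simp add: fibonacci_poset_def F.poset_def)
  let ?E = "associated_hypergraph (rank_selected (fibonacci_poset r) {1, 2}) l"
  have E: "?E \<in> pair_covering_hypergraphs r" by (rule D.hypergraph_pair_covering[OF l])
  show ?thesis
  proof (cases "r = 1")
    case True
    then show ?thesis using E by (simp add: pair_covering_1)
  next
    case False
    have top: "Fib_Refl Fib_Zero \<in> rank_level (fibonacci_poset r) 2"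
      unfolding poset F.rank_level_poset by (simp add: numeral_2_eq_2)
    have "x \<in> covered_set (fibonacci_poset r) (Fib_Refl Fib_Zero)"
      if "x \<in> rank_level (fibonacci_poset r) 1" for x
      using that fib_covers.reflect[OF fib_covers.new[of Fib_Zero r 0]]
      unfolding poset F.rank_level_poset F.covered_set_poset by auto
    then have "covered_set (fibonacci_poset r) (Fib_Refl Fib_Zero) = rank_level (fibonacci_poset r) 1"
      using D.covered_level_2[OF top] by blast
    then have "D.labels l (Fib_Refl Fib_Zero) = {1..r}"
      using l by (simp add: D.labels_def labelling_def bij_betw_def)
    moreover have "2 \<le> card {1..r}" using r False by simp
    ultimately have "{1..r} \<in> ?E"
      unfolding D.associated_hypergraph_eq[OF l] incidence_edges_def using top by force
    then show ?thesis using full_edge_imp_simplex[OF E] False by simp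
  qed
qed

lemma fibonacci_rank_number_2:
  assumes r: "0 < r"
  shows "rank_number (fibonacci_poset r) 2 = r\<^sup>2 + 1"
proof -
  interpret D: differential r "fibonacci_poset r" by (rule fibonacci_differential[OF r])
  obtain l where l: "labelling r (fibonacci_poset r) l" using D.ex_labelling by blast
  \<comment> \<open>At r = 1 the empty sum 0 is again r - 1, so one equation serves both
    cases.\<close>
  have "total_dim (if r = 1 then {} else simplex_hypergraph r) = r - 1"
    by (simp add: total_dim_simplex) (simp add: total_dim_def)
  then have "rank_number (fibonacci_poset r) 2 + (r - 1) = r * (r + 1)"
    using D.rank_number_2[OF l] by (simp only: fibonacci_hypergraph[OF r l])
  then show ?thesis using r by (simp add: power2_eq_square algebra_simps)
qed

text \<open>Links the closed form of the minimum with \<open>r choose 2\<close>, the largest total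
  dimension.\<close>

lemma choose_2_sum: "((r + 2) choose 2) - 1 + (r choose 2) = r * (r + 1)"
  by (induction r) (auto simp: numeral_2_eq_2)

section \<open>Bounds on the number of elements of rank 2\<close>

context differential
begin

lemma rank_number_2_le:
  assumes "0 < r"
  shows "rank_number P 2 \<le> r\<^sup>2 + 1"
proof -
  obtain l where l: "labelling r P l" using ex_labelling by blast
  show ?thesis
    using rank_number_2[OF l] total_dim_ge[OF hypergraph_pair_covering[OF l]] assms
    by (simp add: power2_eq_square)
qed

lemma rank_number_2_ge: "((r + 2) choose 2) - 1 \<le> rank_number P 2"
proof -
  obtain l where l: "labelling r P l" using ex_labelling by blast
  show ?thesis
    using choose_2_sum[of r] rank_number_2[OF l] total_dim_le[OF hypergraph_pair_covering[OF l]] by linarith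
qed

text \<open>A full edge would force the simplex, hence total dimension r - 1 and the maximal value.
  Without it the total dimension is at least \<open>2 * r - 3\<close>.\<close>

lemma rank_number_2_le_second:
  assumes r: "1 < r" and max: "rank_number P 2 \<noteq> r\<^sup>2 + 1"
  shows "rank_number P 2 \<le> r\<^sup>2 - r + 3"
proof -
  obtain l where l: "labelling r P l" using ex_labelling by blast
  let ?E = "associated_hypergraph Q l"
  note E = hypergraph_pair_covering[OF l]
  have sum: "rank_number P 2 + total_dim ?E = r\<^sup>2 + r"
    using rank_number_2[OF l] by (simp add: power2_eq_square)
  have "{1..r} \<notin> ?E"
  proof
    assume "{1..r} \<in> ?E"
    then have "total_dim ?E = r - 1"
      using full_edge_imp_simplex[OF E] total_dim_simplex by simp
    then show False using sum max r by linarith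
  qed
  then have "2 * r - 3 \<le> total_dim ?E" using total_dim_ge_no_full_edge[OF E] r by simp
  moreover have "r \<le> r\<^sup>2" using r by (simp add: power2_eq_square)
  ultimately show ?thesis using sum r by linarith
qed

end

section \<open>Powers of the Young lattice\<close>

text \<open>A poset embedded as a lattice of finite sets, graded by cardinality.  In a distributive lattice
  two distinct elements cover at most their meet and are covered by at most their join, and one of
  these happens if and only if the other does.\<close>

locale set_lattice =
  fixes P :: "'a rel" and S :: "'a \<Rightarrow> 'c set"
  assumes finite_S: "x \<in> Field P \<Longrightarrow> finite (S x)"
    and order: "x \<in> Field P \<Longrightarrow> y \<in> Field P \<Longrightarrow> (x, y) \<in> P \<longleftrightarrow> S x \<subseteq> S y"
    and inj: "x \<in> Field P \<Longrightarrow> y \<in> Field P \<Longrightarrow> S x = S y \<Longrightarrow> x = y"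
    and join: "x \<in> Field P \<Longrightarrow> y \<in> Field P \<Longrightarrow> \<exists>z\<in>Field P. S z = S x \<union> S y"
    and meet: "x \<in> Field P \<Longrightarrow> y \<in> Field P \<Longrightarrow> \<exists>z\<in>Field P. S z = S x \<inter> S y"
    and bottom: "\<exists>z\<in>Field P. S z = {}"
    and step: "x \<in> Field P \<Longrightarrow> y \<in> Field P \<Longrightarrow> S x \<subset> S y \<Longrightarrow>
      \<exists>z\<in>Field P. S x \<subseteq> S z \<and> S z \<subseteq> S y \<and> card (S z) = Suc (card (S x))"
begin

text \<open>By \<open>step\<close>, any strict inclusion passes through a set with one more point,
  so a cover adds exactly one; conversely, a gap of one leaves no room.\<close>

lemma covers_card: "covers P y x \<longleftrightarrow> (x, y) \<in> P \<and> card (S y) = Suc (card (S x))"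
proof
  assume c: "covers P y x"
  then have xy: "x \<in> Field P" "y \<in> Field P" "(x, y) \<in> P" "x \<noteq> y"
    by (auto simp: covers_def Field_def)
  then have "S x \<subset> S y" using order[OF xy(1,2)] inj[OF xy(1,2)] by blast
  then obtain z where z: "z \<in> Field P" "S x \<subseteq> S z" "S z \<subseteq> S y" "card (S z) = Suc (card (S x))"
    using step[OF xy(1,2)] by blast
  then have "(x, z) \<in> P" "(z, y) \<in> P" "z \<noteq> x" using order xy by auto
  then have "z = y" using c by (auto simp: covers_def)
  then show "(x, y) \<in> P \<and> card (S y) = Suc (card (S x))" using z xy by simp
next
  assume xy: "(x, y) \<in> P \<and> card (S y) = Suc (card (S x))"
  then have F: "x \<in> Field P" "y \<in> Field P" by (auto simp: Field_def)
  have "z = x \<or> z = y" if z: "(x, z) \<in> P" "(z, y) \<in> P" for z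
  proof -
    have zF: "z \<in> Field P" using z by (auto simp: Field_def)
    have sub: "S x \<subseteq> S z" "S z \<subseteq> S y"
      using z order[OF F(1) zF] order[OF zF F(2)] by simp_all
    have "card (S x) \<le> card (S z)" "card (S z) \<le> card (S y)"
      using card_mono[OF finite_S[OF zF] sub(1)] card_mono[OF finite_S[OF F(2)] sub(2)] .
    then have "card (S z) = card (S x) \<or> card (S z) = card (S y)" using xy by linarith
    then have "S x = S z \<or> S z = S y"
      using card_subset_eq[OF finite_S[OF zF] sub(1)] card_subset_eq[OF finite_S[OF F(2)] sub(2)] by metis
    then show ?thesis using inj[OF F(1) zF] inj[OF zF F(2)] by metis
  qed
  then show "covers P y x" using xy by (auto simp: covers_def)
qed

sublocale graded_poset P "\<lambda>x. card (S x)"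
proof
  have "(x, x) \<in> P" if "x \<in> Field P" for x using order[OF that that] by simp
  then have "refl_on (Field P) P" by (auto intro!: refl_onI)
  moreover have "trans P"
  proof (rule transI)
    fix x y z assume *: "(x, y) \<in> P" "(y, z) \<in> P"
    then have "x \<in> Field P" "y \<in> Field P" "z \<in> Field P" by (auto simp: Field_def)
    then show "(x, z) \<in> P" using * order by (metis subset_trans)
  qed
  moreover have "antisym P"
  proof (rule antisymI)
    fix x y assume *: "(x, y) \<in> P" "(y, x) \<in> P"
    then have "x \<in> Field P" "y \<in> Field P" by (auto simp: Field_def)
    then show "x = y" using * order inj by (metis subset_antisym)
  qed
  moreover have "P \<subseteq> Field P \<times> Field P" by (auto simp: Field_def)
  ultimately show "Partial_order P"
    by (simp add: partial_order_on_def preorder_on_def)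
  show "locally_finite P"
    unfolding locally_finite_def
  proof (intro allI)
    fix x y
    let ?I = "{z. (x, z) \<in> P \<and> (z, y) \<in> P}"
    have F: "z \<in> Field P" if "z \<in> ?I" for z using that by (auto simp: Field_def)
    show "finite ?I"
    proof (cases "y \<in> Field P")
      case True
      \<comment> \<open>An interval ending at y embeds through S into the finite power set of
        \<open>S y\<close>.\<close>
      have "S z \<subseteq> S y" if "z \<in> ?I" for z using order[OF F[OF that] True] that by simp
      then have "S ` ?I \<subseteq> Pow (S y)" by blast
      then have "finite (S ` ?I)" by (rule finite_subset) (simp add: finite_S[OF True])
      moreover have "inj_on S ?I" by (rule inj_onI) (rule inj[OF F F])
      ultimately show ?thesis by (rule finite_imageD)
    next
      case False
      then have "?I = {}" by (auto simp: Field_def)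
      then show ?thesis by (simp only: finite.emptyI)
    qed
  qed
  have "S x = {}" if "x \<in> minimals P" for x
  proof -
    obtain z where z: "z \<in> Field P" "S z = {}" using bottom by blast
    then have "(z, x) \<in> P" using order[of z x] that by (simp add: minimals_def)
    then show ?thesis using that z by (auto simp: minimals_def)
  qed
  then show "rank_function P (\<lambda>x. card (S x))"
    by (auto simp: rank_function_def covers_card)
qed

lemma unique_rank_0: "\<exists>!x. x \<in> Field P \<and> card (S x) = 0"
proof -
  obtain z where z: "z \<in> Field P" "S z = {}" using bottom by blast
  show ?thesis
  proof (rule ex1I)
    show "z \<in> Field P \<and> card (S z) = 0" using z by simp
    show "x = z" if "x \<in> Field P \<and> card (S x) = 0" for x
      using that z finite_S[of x] by (intro inj) auto
  qed
qed

lemma card_common: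
  assumes x: "x \<in> Field P" and y: "y \<in> Field P" and "x \<noteq> y"
  shows "card (covered_set P x \<inter> covered_set P y) = card (covering_set P x \<inter> covering_set P y)"
proof -
  obtain u where u: "u \<in> Field P" "S u = S x \<union> S y" using join[OF x y] by blast
  obtain m where m: "m \<in> Field P" "S m = S x \<inter> S y" using meet[OF x y] by blast
  have sum: "card (S x) + card (S y) = card (S u) + card (S m)"
    unfolding u m by (rule card_Un_Int[OF finite_S[OF x] finite_S[OF y]])
  have neq: "S x \<noteq> S y" using inj[OF x y] \<open>x \<noteq> y\<close> by blast
  \<comment> \<open>A common upper cover contains the union, which is strictly larger than
    \<open>S x\<close>; having only one point more than \<open>S x\<close>, it equals the
    union.\<close>
  have "z = u" if z: "covers P z x" "covers P z y" for z
  proof -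
    have zF: "z \<in> Field P" and le: "S x \<subseteq> S z" "S y \<subseteq> S z"
      and c: "card (S z) = Suc (card (S x))" "card (S z) = Suc (card (S y))"
      using z x y order by (auto simp: covers_card Field_def)
    have "\<not> S y \<subseteq> S x" using card_subset_eq[OF finite_S[OF x], of "S y"] c neq by auto
    then have "card (S x) < card (S u)"
      unfolding u using finite_S x y by (intro psubset_card_mono) auto
    moreover have "S u \<subseteq> S z" using le u by blast
    ultimately have "S u = S z"
      using card_seteq[OF finite_S[OF zF], of "S u"] c by simp
    then show "z = u" using inj zF u by blast
  qed
  then have up: "covering_set P x \<inter> covering_set P y = (if covers P u x \<and> covers P u y then {u} else {})"
    by (auto simp: covering_set_def)
  have "z = m" if z: "covers P x z" "covers P y z" for z
  proof -
    have zF: "z \<in> Field P" and le: "S z \<subseteq> S x" "S z \<subseteq> S y"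
      and c: "card (S x) = Suc (card (S z))" "card (S y) = Suc (card (S z))"
      using z x y order by (auto simp: covers_card Field_def)
    have "\<not> S x \<subseteq> S y" using card_subset_eq[OF finite_S[OF y], of "S x"] c neq by auto
    then have "card (S m) < card (S x)"
      unfolding m using finite_S x y by (intro psubset_card_mono) auto
    moreover have "S z \<subseteq> S m" using le m by blast
    ultimately have "S z = S m"
      using card_seteq[OF finite_S[OF m(1)], of "S z"] c by simp
    then show "z = m" using inj zF m by blast
  qed
  then have down: "covered_set P x \<inter> covered_set P y = (if covers P x m \<and> covers P y m then {m} else {})"
    by (auto simp: covered_set_def)
  \<comment> \<open>By inclusion-exclusion, u is one larger than x exactly when y is one larger than
    m, and likewise with x and y exchanged.\<close>
  have "covers P u x \<and> covers P u y \<longleftrightarrow> covers P x m \<and> covers P y m"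
    unfolding covers_card using sum order x y u m by auto
  then show ?thesis unfolding up down by simp
qed

end

context
  fixes r :: nat
begin

text \<open>A tuple of partitions is the disjoint union of its diagrams; a pair \<open>(i, a)\<close> stands for row a of
  the i-th diagram.\<close>

definition cells :: "(nat \<Rightarrow> nat \<Rightarrow> nat) \<Rightarrow> (nat \<times> nat \<times> nat) set" where
  "cells f = {(i, a, b). i \<in> {1..r} \<and> b < f i a}"

definition add_cell :: "(nat \<Rightarrow> nat \<Rightarrow> nat) \<Rightarrow> nat \<times> nat \<Rightarrow> nat \<Rightarrow> nat \<Rightarrow> nat" where
  "add_cell f = (\<lambda>(i, a). f(i := (f i)(a := Suc (f i a))))"

definition remove_cell :: "(nat \<Rightarrow> nat \<Rightarrow> nat) \<Rightarrow> nat \<times> nat \<Rightarrow> nat \<Rightarrow> nat \<Rightarrow> nat" where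
  "remove_cell f = (\<lambda>(i, a). f(i := (f i)(a := f i a - 1)))"

definition addable :: "(nat \<Rightarrow> nat \<Rightarrow> nat) \<Rightarrow> (nat \<times> nat) set" where
  "addable f = {(i, a). i \<in> {1..r} \<and> (a = 0 \<or> f i a < f i (a - 1))}"

definition removable :: "(nat \<Rightarrow> nat \<Rightarrow> nat) \<Rightarrow> (nat \<times> nat) set" where
  "removable f = {(i, a). i \<in> {1..r} \<and> f i (Suc a) < f i a}"

abbreviation (input) tuples :: "(nat \<Rightarrow> nat \<Rightarrow> nat) set" where
  "tuples \<equiv> {1..r} \<rightarrow>\<^sub>E partitions"

abbreviation (input) young_power :: "(nat \<Rightarrow> nat \<Rightarrow> nat) rel" where
  "young_power \<equiv> poset_power young_lattice r"

lemma young_diagram_subset: "young_diagram p \<subseteq> young_diagram q \<longleftrightarrow> (\<forall>a. p a \<le> q a)"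
proof
  assume sub: "young_diagram p \<subseteq> young_diagram q"
  show "\<forall>a. p a \<le> q a"
  proof (rule allI, rule ccontr)
    fix a assume "\<not> p a \<le> q a"
    then have "(a, q a) \<in> young_diagram p" by (simp add: young_diagram_def)
    then show False using sub by (auto simp: young_diagram_def)
  qed
qed (auto simp: young_diagram_def intro: less_le_trans)

lemma Field_young_lattice: "Field young_lattice = partitions"
  by (auto simp: Field_def young_lattice_def)

lemma young_power_iff:
  "(f, g) \<in> young_power \<longleftrightarrow> f \<in> tuples \<and> g \<in> tuples \<and> (\<forall>i\<in>{1..r}. \<forall>a. f i a \<le> g i a)"
  unfolding poset_power_def Field_young_lattice
  by (auto simp: young_lattice_def young_diagram_subset PiE_iff)

lemma Field_young_power: "Field young_power = tuples"
proof
  show "Field young_power \<subseteq> tuples" unfolding Field_def using young_power_iff by blast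
  show "tuples \<subseteq> Field young_power"
  proof
    fix f assume "f \<in> tuples"
    then have "(f, f) \<in> young_power" unfolding young_power_iff by blast
    then show "f \<in> Field young_power" unfolding Field_def by blast
  qed
qed

lemma cells_subset: "cells f \<subseteq> cells g \<longleftrightarrow> (\<forall>i\<in>{1..r}. \<forall>a. f i a \<le> g i a)"
proof
  assume sub: "cells f \<subseteq> cells g"
  show "\<forall>i\<in>{1..r}. \<forall>a. f i a \<le> g i a"
  proof (intro ballI allI, rule ccontr)
    fix i a assume "i \<in> {1..r}" "\<not> f i a \<le> g i a"
    then have "(i, a, g i a) \<in> cells f" by (simp add: cells_def)
    then show False using sub by (auto simp: cells_def)
  qed
qed (auto simp: cells_def intro: less_le_trans)

lemma cells_inj:
  assumes "f \<in> tuples" "g \<in> tuples" "cells f = cells g"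
  shows "f = g"
proof (rule PiE_ext[OF assms(1,2)])
  fix i assume "i \<in> {1..r}"
  then show "f i = g i" using assms(3) cells_subset[of f g] cells_subset[of g f]
    by (intro ext antisym) auto
qed

lemma partition_finite: "p \<in> partitions \<Longrightarrow> finite {a. p a \<noteq> 0}"
  by (simp add: partitions_def)

lemma partition_antimono: "p \<in> partitions \<Longrightarrow> a \<le> b \<Longrightarrow> p b \<le> p a"
  by (simp add: partitions_def antimono_def)

lemma partitionI: "(\<And>a. p (Suc a) \<le> p a) \<Longrightarrow> finite {a. p a \<noteq> 0} \<Longrightarrow> p \<in> partitions"
  by (simp add: partitions_def antimono_iff_le_Suc)

lemma finite_cells:
  assumes "f \<in> tuples"
  shows "finite (cells f)"
proof (rule finite_subset)
  show "cells f \<subseteq> (SIGMA i:{1..r}. {a. f i a \<noteq> 0} \<times> {..<f i 0})"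
  proof (clarsimp simp: cells_def)
    fix i a b assume i: "Suc 0 \<le> i" "i \<le> r" "b < f i a"
    then have "f i \<in> partitions" using assms by (auto simp: PiE_iff)
    then have "f i a \<le> f i 0" by (rule partition_antimono) simp
    then show "b < f i 0" using i by simp
  qed
  show "finite (SIGMA i:{1..r}. {a. f i a \<noteq> 0} \<times> {..<f i 0})"
    using assms partition_finite by (intro finite_SigmaI) (auto simp: PiE_iff)
qed

lemma tuplesI:
  assumes "f \<in> tuples" "i \<in> {1..r}" "p \<in> partitions"
  shows "f(i := p) \<in> tuples"
  using assms by (auto simp: PiE_iff extensional_def)

lemma add_cell_tuples:
  assumes f: "f \<in> tuples" and c: "c \<in> addable f"
  shows "add_cell f c \<in> tuples"
proof -
  obtain i a where ia: "c = (i, a)" "i \<in> {1..r}" "a = 0 \<or> f i a < f i (a - 1)"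
    using c by (auto simp: addable_def)
  have p: "f i \<in> partitions" using f ia by (auto simp: PiE_iff)
  have "(f i)(a := Suc (f i a)) \<in> partitions"
  proof (rule partitionI)
    show "((f i)(a := Suc (f i a))) (Suc b) \<le> ((f i)(a := Suc (f i a))) b" for b
      using partition_antimono[OF p, of b "Suc b"] ia(3) by auto
    show "finite {b. ((f i)(a := Suc (f i a))) b \<noteq> 0}"
      by (rule finite_subset[of _ "insert a {b. f i b \<noteq> 0}"]) (use partition_finite[OF p] in auto)
  qed
  then show ?thesis using tuplesI[OF f ia(2)] by (simp add: ia(1) add_cell_def)
qed

lemma remove_cell_tuples:
  assumes f: "f \<in> tuples" and c: "c \<in> removable f"
  shows "remove_cell f c \<in> tuples"
proof -
  obtain i a where ia: "c = (i, a)" "i \<in> {1..r}" "f i (Suc a) < f i a"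
    using c by (auto simp: removable_def)
  have p: "f i \<in> partitions" using f ia by (auto simp: PiE_iff)
  have "(f i)(a := f i a - 1) \<in> partitions"
  proof (rule partitionI)
    show "((f i)(a := f i a - 1)) (Suc b) \<le> ((f i)(a := f i a - 1)) b" for b
      using partition_antimono[OF p, of b "Suc b"] ia(3) by auto
    show "finite {b. ((f i)(a := f i a - 1)) b \<noteq> 0}"
      by (rule finite_subset[of _ "insert a {b. f i b \<noteq> 0}"]) (use partition_finite[OF p] in auto)
  qed
  then show ?thesis using tuplesI[OF f ia(2)] by (simp add: ia(1) remove_cell_def)
qed

lemma cells_add_cell: "i \<in> {1..r} \<Longrightarrow> cells (add_cell f (i, a)) = insert (i, a, f i a) (cells f)"
  by (auto simp: cells_def add_cell_def split: if_splits)

lemma card_cells_add_cell: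
  assumes "f \<in> tuples" "c \<in> addable f"
  shows "card (cells (add_cell f c)) = Suc (card (cells f))" "cells f \<subseteq> cells (add_cell f c)"
proof -
  obtain i a where ia: "c = (i, a)" "i \<in> {1..r}" using assms(2) by (auto simp: addable_def)
  have "(i, a, f i a) \<notin> cells f" by (simp add: cells_def)
  then show "card (cells (add_cell f c)) = Suc (card (cells f))" "cells f \<subseteq> cells (add_cell f c)"
    unfolding ia(1) cells_add_cell[OF ia(2)] using finite_cells[OF assms(1)] by auto
qed

lemma add_remove_cell: "c \<in> removable f \<Longrightarrow> add_cell (remove_cell f c) c = f"
  by (auto simp: add_cell_def remove_cell_def removable_def)

lemma remove_add_cell: "remove_cell (add_cell f c) c = f"
  by (cases c) (simp add: add_cell_def remove_cell_def)

lemma addable_remove_cell: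
  assumes "f \<in> tuples" "c \<in> removable f"
  shows "c \<in> addable (remove_cell f c)"
proof -
  obtain i a where ia: "c = (i, a)" "i \<in> {1..r}" "f i (Suc a) < f i a"
    using assms(2) by (auto simp: removable_def)
  have "f i \<in> partitions" using assms(1) ia by (auto simp: PiE_iff)
  then have "f i a \<le> f i (a - 1)" by (rule partition_antimono) simp
  then show ?thesis using ia by (auto simp: addable_def remove_cell_def)
qed

lemma removable_add_cell:
  assumes "f \<in> tuples" "c \<in> addable f"
  shows "c \<in> removable (add_cell f c)"
proof -
  obtain i a where ia: "c = (i, a)" "i \<in> {1..r}" using assms(2) by (auto simp: addable_def)
  have "f i \<in> partitions" using assms(1) ia by (auto simp: PiE_iff)
  then have "f i (Suc a) \<le> f i a" by (rule partition_antimono) simp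
  then show ?thesis using ia by (auto simp: removable_def add_cell_def)
qed

text \<open>In a component where f is smaller, take the first row a in which it is. If a > 0, the
  previous row of f is at least that of g, hence at least \<open>g i a\<close>, hence longer than
  \<open>f i a\<close>; so a cell fits at the end of row a.\<close>

lemma ex_addable:
  assumes f: "f \<in> tuples" and g: "g \<in> tuples" and lt: "cells f \<subset> cells g"
  obtains c where "c \<in> addable f" "cells (add_cell f c) \<subseteq> cells g"
proof -
  have le: "\<forall>i\<in>{1..r}. \<forall>a. f i a \<le> g i a" using lt cells_subset by blast
  have "\<not> cells g \<subseteq> cells f" using lt by blast
  then obtain i b where i: "i \<in> {1..r}" and b: "f i b < g i b"
    unfolding cells_subset by (auto simp: not_le)
  define a where "a = (LEAST a. f i a < g i a)"
  have a: "f i a < g i a" unfolding a_def by (rule LeastI[of "\<lambda>a. f i a < g i a", OF b])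
  have "f i a < f i (a - 1)" if "a \<noteq> 0"
  proof -
    have "\<not> f i (a - 1) < g i (a - 1)"
      using not_less_Least[of "a - 1" "\<lambda>a. f i a < g i a"] that by (simp add: a_def)
    moreover have "g i \<in> partitions" using g i by (auto simp: PiE_iff)
    then have "g i a \<le> g i (a - 1)" by (rule partition_antimono) simp
    ultimately show ?thesis using a by linarith
  qed
  then have "(i, a) \<in> addable f" using i by (auto simp: addable_def)
  moreover have "cells (add_cell f (i, a)) \<subseteq> cells g"
    using lt a i by (auto simp: cells_add_cell) (simp add: cells_def)
  ultimately show ?thesis by (rule that)
qed

lemma set_lattice_young_power: "set_lattice young_power cells"
proof (unfold_locales, unfold Field_young_power)
  show "finite (cells f)" if "f \<in> tuples" for f by (rule finite_cells[OF that])
  show "(f, g) \<in> young_power \<longleftrightarrow> cells f \<subseteq> cells g" if "f \<in> tuples" "g \<in> tuples" for f g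
    using that unfolding young_power_iff cells_subset by blast
  show "f = g" if "f \<in> tuples" "g \<in> tuples" "cells f = cells g" for f g
    by (rule cells_inj[OF that])
  show "\<exists>h\<in>tuples. cells h = cells f \<union> cells g" if fg: "f \<in> tuples" "g \<in> tuples" for f g
  proof (rule bexI)
    let ?h = "\<lambda>i. if i \<in> {1..r} then \<lambda>a. max (f i a) (g i a) else undefined"
    show "cells ?h = cells f \<union> cells g" by (auto simp: cells_def less_max_iff_disj)
    have "(\<lambda>a. max (f i a) (g i a)) \<in> partitions" if "i \<in> {1..r}" for i
    proof (rule partitionI)
      have p: "f i \<in> partitions" "g i \<in> partitions" using fg that by (auto simp: PiE_iff)
      show "max (f i (Suc a)) (g i (Suc a)) \<le> max (f i a) (g i a)" for a
        using partition_antimono[OF p(1), of a "Suc a"] partition_antimono[OF p(2), of a "Suc a"] by linarith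
      show "finite {a. max (f i a) (g i a) \<noteq> 0}"
        by (rule finite_subset[of _ "{a. f i a \<noteq> 0} \<union> {a. g i a \<noteq> 0}"])
          (use partition_finite[OF p(1)] partition_finite[OF p(2)] in auto)
    qed
    then show "?h \<in> tuples" by (auto simp: PiE_iff extensional_def)
  qed
  show "\<exists>h\<in>tuples. cells h = cells f \<inter> cells g" if fg: "f \<in> tuples" "g \<in> tuples" for f g
  proof (rule bexI)
    let ?h = "\<lambda>i. if i \<in> {1..r} then \<lambda>a. min (f i a) (g i a) else undefined"
    show "cells ?h = cells f \<inter> cells g" by (auto simp: cells_def)
    have "(\<lambda>a. min (f i a) (g i a)) \<in> partitions" if "i \<in> {1..r}" for i
    proof (rule partitionI)
      have p: "f i \<in> partitions" "g i \<in> partitions" using fg that by (auto simp: PiE_iff)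
      show "min (f i (Suc a)) (g i (Suc a)) \<le> min (f i a) (g i a)" for a
        using partition_antimono[OF p(1), of a "Suc a"] partition_antimono[OF p(2), of a "Suc a"] by linarith
      show "finite {a. min (f i a) (g i a) \<noteq> 0}"
        by (rule finite_subset[of _ "{a. f i a \<noteq> 0}"]) (use partition_finite[OF p(1)] in auto)
    qed
    then show "?h \<in> tuples" by (auto simp: PiE_iff extensional_def)
  qed
  show "\<exists>h\<in>tuples. cells h = {}"
    by (rule bexI[of _ "\<lambda>i\<in>{1..r}. \<lambda>a. 0"])
      (auto simp: cells_def PiE_iff extensional_def intro: partitionI)
  show "\<exists>h\<in>tuples. cells f \<subseteq> cells h \<and> cells h \<subseteq> cells g \<and> card (cells h) = Suc (card (cells f))"
    if fg: "f \<in> tuples" "g \<in> tuples" "cells f \<subset> cells g" for f g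
  proof -
    obtain c where c: "c \<in> addable f" "cells (add_cell f c) \<subseteq> cells g" by (rule ex_addable[OF fg])
    then show ?thesis
      using add_cell_tuples[OF fg(1) c(1)] card_cells_add_cell[OF fg(1) c(1)] by blast
  qed
qed

interpretation Y: set_lattice young_power cells by (rule set_lattice_young_power)

section \<open>Covers in powers of the Young lattice\<close>

lemma covers_add_cell:
  assumes f: "f \<in> tuples" and c: "c \<in> addable f"
  shows "covers young_power (add_cell f c) f"
  using Y.order[of f "add_cell f c"] f add_cell_tuples[OF f c] card_cells_add_cell[OF f c]
  by (simp add: Y.covers_card Field_young_power)

text \<open>Some added cell keeps f inside g, and since g has only one cell more, the two diagrams
  agree.\<close>

lemma covers_imp_add_cell:
  assumes cov: "covers young_power g f"
  obtains c where "c \<in> addable f" "g = add_cell f c"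
proof -
  have fg: "(f, g) \<in> young_power" "card (cells g) = Suc (card (cells f))"
    using cov by (auto simp: Y.covers_card)
  then have F: "f \<in> tuples" "g \<in> tuples" by (auto simp: young_power_iff)
  have "cells f \<subseteq> cells g" using fg(1) unfolding young_power_iff cells_subset by blast
  then have "cells f \<subset> cells g" using fg(2) by auto
  then obtain c where c: "c \<in> addable f" "cells (add_cell f c) \<subseteq> cells g"
    by (rule ex_addable[OF F])
  then have "cells (add_cell f c) = cells g"
    using card_cells_add_cell(1)[OF F(1) c(1)] fg(2) by (intro card_subset_eq[OF finite_cells[OF F(2)]]) auto
  then show ?thesis using that c cells_inj add_cell_tuples[OF F(1) c(1)] F by metis
qed

lemma covering_set_young_power:
  assumes f: "f \<in> tuples"
  shows "covering_set young_power f = add_cell f ` addable f"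
  unfolding covering_set_def using covers_add_cell[OF f] by (auto elim: covers_imp_add_cell)

lemma covered_set_young_power:
  assumes g: "g \<in> tuples"
  shows "covered_set young_power g = remove_cell g ` removable g"
proof
  show "covered_set young_power g \<subseteq> remove_cell g ` removable g"
  proof
    fix f assume "f \<in> covered_set young_power g"
    then have cov: "covers young_power g f" by (simp add: covered_set_def)
    then obtain c where c: "c \<in> addable f" "g = add_cell f c" by (rule covers_imp_add_cell)
    moreover have "f \<in> tuples" using cov by (auto simp: covers_def young_power_iff)
    ultimately have "c \<in> removable g" "f = remove_cell g c"
      using removable_add_cell remove_add_cell by auto
    then show "f \<in> remove_cell g ` removable g" by blast
  qed
  show "remove_cell g ` removable g \<subseteq> covered_set young_power g"
  proof
    fix f assume "f \<in> remove_cell g ` removable g"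
    then obtain c where c: "c \<in> removable g" "f = remove_cell g c" by blast
    then show "f \<in> covered_set young_power g"
      using covers_add_cell[OF remove_cell_tuples[OF g c(1)] addable_remove_cell[OF g c(1)]]
      by (simp add: covered_set_def add_remove_cell)
  qed
qed

lemma inj_on_add_cell: "inj_on (add_cell f) (addable f)"
proof (rule inj_onI)
  fix c d assume eq: "add_cell f c = add_cell f d"
  obtain i a j b where cd: "c = (i, a)" "d = (j, b)" by (metis surj_pair)
  have "add_cell f c i a = Suc (f i a)" by (simp add: cd add_cell_def)
  moreover have "add_cell f d i a = f i a" if "(i, a) \<noteq> (j, b)"
    using that by (auto simp: cd add_cell_def)
  ultimately show "c = d" using eq cd by (metis n_not_Suc_n)
qed

lemma inj_on_remove_cell: "inj_on (remove_cell f) (removable f)"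
proof (rule inj_onI)
  fix c d assume c: "c \<in> removable f" and eq: "remove_cell f c = remove_cell f d"
  obtain i a j b where cd: "c = (i, a)" "d = (j, b)" by (metis surj_pair)
  have "remove_cell f c i a < f i a" using c by (auto simp: cd remove_cell_def removable_def)
  moreover have "remove_cell f d i a = f i a" if "(i, a) \<noteq> (j, b)"
    using that by (auto simp: cd remove_cell_def)
  ultimately show "c = d" using eq cd by (metis less_irrefl)
qed

text \<open>A removable row is nonempty, so its leading cell witnesses it. The bound limits the
  number of atoms below an element of rank 2.\<close>

lemma removable_cells:
  assumes f: "f \<in> tuples"
  shows "finite (removable f)" "card (removable f) \<le> card (cells f)"
proof -
  have inj: "inj_on (\<lambda>(i, a). (i, a, 0::nat)) (removable f)" by (auto intro: inj_onI)
  have sub: "(\<lambda>(i, a). (i, a, 0)) ` removable f \<subseteq> cells f"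
    by (auto simp: removable_def cells_def)
  show "finite (removable f)"
    by (rule finite_imageD[OF finite_subset[OF sub finite_cells[OF f]] inj])
  show "card (removable f) \<le> card (cells f)"
    by (rule card_inj_on_le[OF inj sub finite_cells[OF f]])
qed

text \<open>An addable row is either row 0 of one of the r components or the row directly after a
  removable one. The r leading rows make up the surplus.\<close>

lemma card_addable:
  assumes f: "f \<in> tuples"
  shows "finite (addable f)" "card (addable f) = card (removable f) + r"
proof -
  let ?A = "(\<lambda>i. (i, 0::nat)) ` {1..r}" and ?B = "(\<lambda>(i, a). (i, Suc a)) ` removable f"
  have eq: "addable f = ?A \<union> ?B"
  proof
    show "addable f \<subseteq> ?A \<union> ?B"
    proof
      fix c assume "c \<in> addable f"
      then obtain i a where ia: "c = (i, a)" "i \<in> {1..r}" "a = 0 \<or> f i a < f i (a - 1)"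
        by (auto simp: addable_def)
      then show "c \<in> ?A \<union> ?B" by (cases a) (force simp: removable_def)+
    qed
  qed (auto simp: addable_def removable_def)
  then show "finite (addable f)" using removable_cells(1)[OF f] by simp
  have "card (addable f) = card ?A + card ?B"
    unfolding eq using removable_cells(1)[OF f] by (intro card_Un_disjoint) auto
  also have "card ?A = r" by (simp add: card_image inj_on_def)
  also have "card ?B = card (removable f)" by (rule card_image) (auto intro: inj_onI)
  finally show "card (addable f) = card (removable f) + r" by simp
qed

lemma differential_young_power: "differential r young_power"
proof (unfold_locales, rule Y.differential_posetI[OF Y.unique_rank_0])
  fix f assume "f \<in> Field young_power"
  then have f: "f \<in> tuples" by (simp add: Field_young_power)
  show "finite (covered_set young_power f)" "finite (covering_set young_power f)"
    using covered_set_young_power[OF f] covering_set_young_power[OF f] removable_cells(1)[OF f]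
      card_addable(1)[OF f] by auto
  show "card (covering_set young_power f) = card (covered_set young_power f) + r"
    using covered_set_young_power[OF f] covering_set_young_power[OF f] card_addable(2)[OF f]
      card_image[OF inj_on_add_cell[of f]] card_image[OF inj_on_remove_cell[of f]] by simp
qed (rule Y.card_common)

text \<open>Two cells allow at most two removals, so an element of rank 2 covers at most two atoms
  and every edge is a pair.\<close>

lemma young_power_hypergraph:
  assumes l: "labelling r young_power l"
  shows "associated_hypergraph (rank_selected young_power {1, 2}) l = complete_graph r"
proof -
  interpret D: differential r young_power by (rule differential_young_power)
  show ?thesis
  proof (rule complete_graph_unique[OF D.hypergraph_pair_covering[OF l]])
    fix F assume "F \<in> associated_hypergraph (rank_selected young_power {1, 2}) l"
    then obtain x where x: "x \<in> rank_level young_power 2" "F = D.labels l x"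
      unfolding D.associated_hypergraph_eq[OF l] incidence_edges_def by blast
    then have t: "x \<in> tuples" "card (cells x) = 2"
      using Y.rank_level by (auto simp: Field_young_power)
    have "card F = card (covered_set young_power x)" using D.card_labels[OF l x(1)] x(2) by simp
    also have "\<dots> = card (removable x)"
      unfolding covered_set_young_power[OF t(1)] by (rule card_image[OF inj_on_remove_cell])
    also have "\<dots> \<le> 2" using removable_cells(2)[OF t(1)] t(2) by simp
    finally show "card F \<le> 2" .
  qed
qed

end

section \<open>Classification and extremal values\<close>

text \<open>Each class has a single hypergraph, which \<open>the_elem\<close> reads off.
  \<open>labelled_iso_iff\<close> separates the classes, and
  \<open>ex_differential_hypergraph\<close> provides preimages.\<close>

lemma labelled_subposets_bij:
  assumes r: "0 < r" and inf: "infinite (UNIV :: 'a set)"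
  shows "bij_betw (\<lambda>C. the_elem ((\<lambda>(Q, l). associated_hypergraph Q l) ` C))
    ((labelled_subposets r :: ('a rel \<times> ('a \<Rightarrow> nat)) set) // labelled_iso r)
    (pair_covering_hypergraphs r)"
proof -
  let ?A = "labelled_subposets r :: ('a rel \<times> ('a \<Rightarrow> nat)) set"
  let ?H = "\<lambda>(Q :: 'a rel, l). associated_hypergraph Q l"
  let ?cls = "\<lambda>X. labelled_iso r `` {X} :: ('a rel \<times> ('a \<Rightarrow> nat)) set"
  have the: "the_elem (?H ` ?cls X) = ?H X" if X: "X \<in> ?A" for X
  proof -
    have "?H ` ?cls X = {?H X}"
    proof
      show "?H ` ?cls X \<subseteq> {?H X}"
      proof (rule image_subsetI)
        fix Y assume "Y \<in> ?cls X"
        then have "?H X = ?H Y" unfolding Image_singleton_iff labelled_iso_iff by blast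
        then show "?H Y \<in> {?H X}" by (simp only: singleton_iff)
      qed
      have "X \<in> ?cls X" using X unfolding Image_singleton_iff labelled_iso_iff by blast
      then show "{?H X} \<subseteq> ?H ` ?cls X" by blast
    qed
    then show ?thesis by (simp only: the_elem_eq)
  qed
  show ?thesis
  proof (rule bij_betw_imageI)
    show "inj_on (\<lambda>C. the_elem (?H ` C)) (?A // labelled_iso r)"
    proof (rule inj_onI)
      fix C D assume C: "C \<in> ?A // labelled_iso r" and D: "D \<in> ?A // labelled_iso r"
        and eq: "the_elem (?H ` C) = the_elem (?H ` D)"
      obtain X where X: "X \<in> ?A" "C = ?cls X" using C by (rule quotientE)
      obtain Y where Y: "Y \<in> ?A" "D = ?cls Y" using D by (rule quotientE)
      have "?H X = ?H Y" using eq the[OF X(1)] the[OF Y(1)] X(2) Y(2) by simp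
      then have "(X, Y) \<in> labelled_iso r" using X(1) Y(1) unfolding labelled_iso_iff by (intro conjI)
      then show "C = D" unfolding X(2) Y(2) by (rule equiv_class_eq[OF equiv_labelled_iso])
    qed
    show "(\<lambda>C. the_elem (?H ` C)) ` (?A // labelled_iso r) = pair_covering_hypergraphs r"
    proof
      show "(\<lambda>C. the_elem (?H ` C)) ` (?A // labelled_iso r) \<subseteq> pair_covering_hypergraphs r"
      proof
        fix E assume "E \<in> (\<lambda>C. the_elem (?H ` C)) ` (?A // labelled_iso r)"
        then obtain C where C: "C \<in> ?A // labelled_iso r" "E = the_elem (?H ` C)" by blast
        obtain X where X: "X \<in> ?A" "C = ?cls X" using C(1) by (rule quotientE)
        have "E = ?H X" using C(2) X(2) the[OF X(1)] by simp
        moreover have "?H X \<in> pair_covering_hypergraphs r"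
          using labelled_pair_covering[of "fst X" "snd X"] X(1) by (simp add: case_prod_beta)
        ultimately show "E \<in> pair_covering_hypergraphs r" by simp
      qed
      show "pair_covering_hypergraphs r \<subseteq> (\<lambda>C. the_elem (?H ` C)) ` (?A // labelled_iso r)"
      proof
        fix E assume "E \<in> pair_covering_hypergraphs r"
        then obtain P :: "'a rel" and l where P: "differential r P" "labelling r P l"
          "associated_hypergraph (rank_selected P {1, 2}) l = E"
          by (rule ex_differential_hypergraph[OF r inf])
        let ?X = "(rank_selected P {1, 2}, l)"
        have X: "?X \<in> ?A" by (rule labelled_subposetsI[OF P(1,2)])
        have "the_elem (?H ` ?cls ?X) = E" using the[OF X] P(3) by simp
        then show "E \<in> (\<lambda>C. the_elem (?H ` C)) ` (?A // labelled_iso r)"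
          using quotientI[OF X] by (metis (no_types, lifting) image_eqI)
      qed
    qed
  qed
qed

lemma ex_differential_rank_number_2:
  assumes "0 < r" "infinite (UNIV :: 'a set)" "E \<in> pair_covering_hypergraphs r"
    "n + total_dim E = r * (r + 1)"
  obtains P :: "'a rel" and l where "differential_poset r P" "labelling r P l"
    "rank_number P 2 = n" "associated_hypergraph (rank_selected P {1, 2}) l = E"
proof -
  obtain P :: "'a rel" and l where P: "differential r P" "labelling r P l"
    "associated_hypergraph (rank_selected P {1, 2}) l = E"
    by (rule ex_differential_hypergraph[OF assms(1-3)])
  have "rank_number P 2 = n"
    using differential.rank_number_2[OF P(1,2)] P(3) assms(4) by simp
  then show ?thesis using that P by (auto simp: differential_def)
qed

lemma young_power_rank_number_2:
  "rank_number (poset_power young_lattice r) 2 = ((r + 2) choose 2) - 1"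
proof -
  interpret differential r "poset_power young_lattice r" by (rule differential_young_power)
  obtain l where l: "labelling r (poset_power young_lattice r) l" using ex_labelling by blast
  show ?thesis
    using rank_number_2[OF l] choose_2_sum[of r]
    unfolding young_power_hypergraph[OF l] total_dim_complete_graph by linarith
qed

text \<open>Extremal values are claimed to occur in the given type as well as for
  \<open>fibonacci_poset r\<close> and \<open>poset_power young_lattice r\<close>, which live on
  types of their own. The near-pencil clause asks for r > 2: at r = 2 both r^2 - r + 3 and r^2 + 1
  are 5, and the long edge would have dimension 0.\<close>

theorem proposition3:
  fixes r :: nat
  assumes "r > 0" and "infinite (UNIV :: 'a set)"
  shows
    "(equiv (labelled_subposets r :: ('a rel \<times> ('a \<Rightarrow> nat)) set) (labelled_iso r) \<and>
      (\<lambda>(Q, l). associated_hypergraph Q l) respects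
        (labelled_iso r :: (('a rel \<times> ('a \<Rightarrow> nat)) \<times> ('a rel \<times> ('a \<Rightarrow> nat))) set) \<and>
      bij_betw (\<lambda>C. the_elem ((\<lambda>(Q, l). associated_hypergraph Q l) ` C))
        ((labelled_subposets r :: ('a rel \<times> ('a \<Rightarrow> nat)) set) // labelled_iso r)
        (pair_covering_hypergraphs r) \<and>
      (\<forall>(Q, l) \<in> (labelled_subposets r :: ('a rel \<times> ('a \<Rightarrow> nat)) set).
       \<forall>(Q', l') \<in> (labelled_subposets r :: ('a rel \<times> ('a \<Rightarrow> nat)) set).
         (\<exists>f. iso Q Q' f) \<longleftrightarrow>
         (\<exists>\<pi>. bij_betw \<pi> {1..r} {1..r} \<and>
              associated_hypergraph Q' l' = (\<lambda>F. \<pi> ` F) ` associated_hypergraph Q l)))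
     \<and>
     (\<forall>P :: 'a rel. differential_poset r P \<longrightarrow>
        rank_number P 0 = 1 \<and> rank_number P 1 = r \<and>
        (\<forall>l. labelling r P l \<longrightarrow>
           int (rank_number P 2) =
             int (r * (r + 1)) - int (total_dim (associated_hypergraph (rank_selected P {1, 2}) l))))
     \<and>
     ((\<exists>P :: 'a rel. differential_poset r P \<and> rank_number P 2 = r\<^sup>2 + 1) \<and>
      (\<forall>P :: 'a rel. differential_poset r P \<longrightarrow> rank_number P 2 \<le> r\<^sup>2 + 1) \<and>
      differential_poset r (fibonacci_poset r) \<and>
      rank_number (fibonacci_poset r) 2 = r\<^sup>2 + 1 \<and>
      (\<forall>l. labelling r (fibonacci_poset r) l \<longrightarrow>
         associated_hypergraph (rank_selected (fibonacci_poset r) {1, 2}) l =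
           (if r = 1 then {} else simplex_hypergraph r)))
     \<and>
     (r > 1 \<longrightarrow>
        (\<exists>P :: 'a rel. differential_poset r P \<and> rank_number P 2 = r\<^sup>2 - r + 3) \<and>
        (\<forall>P :: 'a rel. differential_poset r P \<and> rank_number P 2 \<noteq> r\<^sup>2 + 1 \<longrightarrow>
           rank_number P 2 \<le> r\<^sup>2 - r + 3) \<and>
        (r > 2 \<longrightarrow>
           r\<^sup>2 - r + 3 < r\<^sup>2 + 1 \<and>
           (\<exists>(P :: 'a rel) l F G. differential_poset r P \<and> labelling r P l \<and>
              rank_number P 2 = r\<^sup>2 - r + 3 \<and>
              associated_hypergraph (rank_selected P {1, 2}) l = insert F G \<and> F \<notin> G \<and>
              edge_dim F = r - 2 \<and> card G = r - 1 \<and> (\<forall>e\<in>G. edge_dim e = 1))))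
     \<and>
     ((\<exists>P :: 'a rel. differential_poset r P \<and> rank_number P 2 = ((r + 2) choose 2) - 1) \<and>
      (\<forall>P :: 'a rel. differential_poset r P \<longrightarrow> ((r + 2) choose 2) - 1 \<le> rank_number P 2) \<and>
      differential_poset r (poset_power young_lattice r) \<and>
      rank_number (poset_power young_lattice r) 2 = ((r + 2) choose 2) - 1 \<and>
      (\<forall>l. labelling r (poset_power young_lattice r) l \<longrightarrow>
         associated_hypergraph (rank_selected (poset_power young_lattice r) {1, 2}) l =
           complete_graph r))"
    (is "?bijection \<and> ?formula \<and> ?maximum \<and> ?second \<and> ?minimum")
proof -
  have r: "0 < r" by (rule assms(1))
  have D: "differential r P" if "differential_poset r P" for P :: "'a rel"
    using that by (simp add: differential_def)
  have r_le: "r \<le> r\<^sup>2" by (simp add: power2_eq_square)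
  have max: "\<exists>P :: 'a rel. differential_poset r P \<and> rank_number P 2 = r\<^sup>2 + 1"
  proof -
    let ?E = "if r = 1 then {} else simplex_hypergraph r"
    have "?E \<in> pair_covering_hypergraphs r"
      using simplex_pair_covering[of r] r pair_covering_1 by auto
    moreover have "total_dim ?E = r - 1"
      by (simp add: total_dim_simplex) (simp add: total_dim_def)
    then have "r\<^sup>2 + 1 + total_dim ?E = r * (r + 1)" using r by (simp add: power2_eq_square)
    ultimately show ?thesis by (rule ex_differential_rank_number_2[OF assms]) blast
  qed
  have min: "\<exists>P :: 'a rel. differential_poset r P \<and> rank_number P 2 = ((r + 2) choose 2) - 1"
    using choose_2_sum[of r] unfolding total_dim_complete_graph[symmetric]
    by (rule ex_differential_rank_number_2[OF assms complete_graph_pair_covering]) blast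
  have second: "\<exists>(P :: 'a rel) l F G. differential_poset r P \<and> labelling r P l \<and>
      rank_number P 2 = r\<^sup>2 - r + 3 \<and>
      associated_hypergraph (rank_selected P {1, 2}) l = insert F G \<and> F \<notin> G \<and>
      edge_dim F = r - 2 \<and> card G = r - 1 \<and> (\<forall>e\<in>G. edge_dim e = 1)" if r2: "2 < r"
  proof -
    note N = near_pencil[OF r2]
    have "r * (r + 1) = r\<^sup>2 + r" by (simp add: power2_eq_square)
    then have "r\<^sup>2 - r + 3 + (2 * r - 3) = r * (r + 1)" using r_le r2 by linarith
    then have "r\<^sup>2 - r + 3 + total_dim (insert {1..r - 1} ((\<lambda>i. {i, r}) ` {1..r - 1})) = r * (r + 1)"
      unfolding N(6) .
    then obtain P :: "'a rel" and l where "differential_poset r P" "labelling r P l"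
      "rank_number P 2 = r\<^sup>2 - r + 3"
      "associated_hypergraph (rank_selected P {1, 2}) l = insert {1..r - 1} ((\<lambda>i. {i, r}) ` {1..r - 1})"
      by (rule ex_differential_rank_number_2[OF assms N(1)])
    then show ?thesis using N(2-5) by blast
  qed
  have ?bijection
    by (intro conjI congruentI equiv_labelled_iso labelled_subposets_bij[OF assms],
        unfold labelled_iso_iff, blast)
      (unfold case_prod_beta, intro ballI, rule iso_iff_hypergraph, simp_all)
  moreover have ?formula
  proof (intro allI impI conjI)
    fix P :: "'a rel" assume "differential_poset r P"
    then interpret differential r P by (rule D)
    show "rank_number P 0 = 1" "rank_number P 1 = r" by (rule rank_number_0_1)+
    fix l assume "labelling r P l"
    from rank_number_2[OF this]
    show "int (rank_number P 2) =
        int (r * (r + 1)) - int (total_dim (associated_hypergraph (rank_selected P {1, 2}) l))"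
      by linarith
  qed
  moreover have ?maximum
  proof (intro conjI allI impI)
    show "rank_number P 2 \<le> r\<^sup>2 + 1" if "differential_poset r P" for P :: "'a rel"
      by (rule differential.rank_number_2_le[OF D[OF that] r])
    show "differential_poset r (fibonacci_poset r)"
      by (rule differential.diff[OF fibonacci_differential[OF r]])
  qed (rule max, rule fibonacci_rank_number_2[OF r], rule fibonacci_hypergraph[OF r])
  moreover have ?second
  proof (intro impI conjI)
    assume r1: "1 < r"
    show "\<exists>P :: 'a rel. differential_poset r P \<and> rank_number P 2 = r\<^sup>2 - r + 3"
    proof (cases "r = 2")
      \<comment> \<open>Here r^2 - r + 3 = r^2 + 1, so a poset attaining the maximum is the
        witness.\<close>
      case True
      then show ?thesis using max by simp
    next
      case False
      then show ?thesis using second r1 by fastforce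
    qed
    show "\<forall>P :: 'a rel. differential_poset r P \<and> rank_number P 2 \<noteq> r\<^sup>2 + 1 \<longrightarrow>
        rank_number P 2 \<le> r\<^sup>2 - r + 3"
    proof (intro allI impI)
      show "rank_number P 2 \<le> r\<^sup>2 - r + 3"
        if "differential_poset r P \<and> rank_number P 2 \<noteq> r\<^sup>2 + 1" for P :: "'a rel"
        using differential.rank_number_2_le_second[OF D r1] that by blast
    qed
    show "r\<^sup>2 - r + 3 < r\<^sup>2 + 1" if "2 < r" using that r_le by linarith
  qed (rule second)
  moreover have ?minimum
  proof (intro conjI allI impI)
    show "((r + 2) choose 2) - 1 \<le> rank_number P 2" if "differential_poset r P" for P :: "'a rel"
      by (rule differential.rank_number_2_ge[OF D[OF that]])
    show "differential_poset r (poset_power young_lattice r)"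
      by (rule differential.diff[OF differential_young_power])
  qed (rule min, rule young_power_rank_number_2, rule young_power_hypergraph)
  ultimately show ?thesis by blast
qed

end
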